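(* Let $F$ be a symmetrizable family of graphs (all of the same order). Then for any graph $H$ with $\chi(H)\ge 3$ it holds that $i_H(F)=i_{\chi(H)}(F)$. In particular, $i_H(F)$ is attained by a complete $\ell$-partite graphon for some $\ell<\chi(H)$.
   Context: All graphs are finite and simple; $\chi(H)$ is the chromatic number. A graph is $H$-free if it does not contain $H$ as a (not necessarily induced) subgraph. For a family $F$ of graphs, all on the same number $r$ of vertices (closed under isomorphism), $P(F,G)$ is the number of $r$-subsets of $V(G)$ inducing a subgraph isomorphic to an element of $F$, and $p(F,G)=P(F,G)/\binom{|V(G)|}{r}$. $i_H(F,n)$ is the maximum of $p(F,G)$ over all $H$-free graphs $G$ with $n$ vertices, $i_H(F)=\lim_{n\to\infty}i_H(F,n)$ (the limit exists), and $i_k(F)=i_{K_k}(F)$. Symmetrization: given two nonadjacent vertices $x,y$ of a graph, replace $x$ with a copy of $y$, keeping $y$ and its clone nonadjacent (so $y$ and its clone have identical neighborhoods). A family of graphs is symmetrizable if it is closed under this operation (for every graph in the family and every pair of nonadjacent vertices). For $x_1,\ldots,x_\ell>0$ with $\sum x_i=1$, the complete $\ell$-partite graphon $W[x_1,\ldots,x_\ell]:[0,1]^2\to\{0,1\}$ is defined by partitioning $[0,1]$ into intervals of lengths $x_1,\ldots,x_\ell$ and setting $W(x,y)=1$ if and only if $x,y$ lie in distinct intervals. The induced density of $F$ in $W$ is the probability that $r$ independent uniform points of $[0,1]$ induce a graph isomorphic to an element of $F$, where distinct points $u,v$ are adjacent iff $W(u,v)=1$. The value $i_H(F)$ is attained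 by $W$ if the induced density of $F$ in $W$ equals $i_H(F)$. *)

theory Defs
  imports "HOL-Probability.Probability"
begin

section \<open>Finite simple graphs\<close>

text \<open>A graph is a pair of a vertex set and a symmetric, irreflexive adjacency relation.\<close>

type_synonym 'a graph = "'a set \<times> ('a \<times> 'a) set"

abbreviation verts :: "'a graph \<Rightarrow> 'a set" where "verts G \<equiv> fst G"
abbreviation edges :: "'a graph \<Rightarrow> ('a \<times> 'a) set" where "edges G \<equiv> snd G"

definition simple_graph :: "'a graph \<Rightarrow> bool" where
  "simple_graph G \<longleftrightarrow>
     finite (verts G) \<and> edges G \<subseteq> verts G \<times> verts G \<and> sym (edges G) \<and> irrefl (edges G)"

definition graph_iso :: "'a graph \<Rightarrow> 'b graph \<Rightarrow> bool" where
  "graph_iso G G' \<longleftrightarrow>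
     (\<exists>f. bij_betw f (verts G) (verts G') \<and>
          (\<forall>u\<in>verts G. \<forall>v\<in>verts G. (u, v) \<in> edges G \<longleftrightarrow> (f u, f v) \<in> edges G'))"

definition induced_subgraph :: "'a graph \<Rightarrow> 'a set \<Rightarrow> 'a graph" where
  "induced_subgraph G S = (S, edges G \<inter> S \<times> S)"

definition contains_subgraph :: "'a graph \<Rightarrow> 'b graph \<Rightarrow> bool" where
  "contains_subgraph G H \<longleftrightarrow>
     (\<exists>f. inj_on f (verts H) \<and> f ` verts H \<subseteq> verts G \<and>
          (\<forall>u\<in>verts H. \<forall>v\<in>verts H. (u, v) \<in> edges H \<longrightarrow> (f u, f v) \<in> edges G))"

definition complete_nat_graph :: "nat \<Rightarrow> nat graph" where
  "complete_nat_graph k = ({..<k}, {(i, j). i < k \<and> j < k \<and> i \<noteq> j})"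

definition proper_colouring :: "'a graph \<Rightarrow> nat \<Rightarrow> ('a \<Rightarrow> nat) \<Rightarrow> bool" where
  "proper_colouring G k c \<longleftrightarrow>
     (\<forall>v\<in>verts G. c v < k) \<and> (\<forall>(u, v)\<in>edges G. c u \<noteq> c v)"

definition chromatic_number :: "'a graph \<Rightarrow> nat" where
  "chromatic_number G = (LEAST k. \<exists>c. proper_colouring G k c)"


section \<open>Families of graphs and inducibility\<close>

text \<open>Since families are closed under isomorphism, nothing is lost by taking their members
  (and the host graphs below) on vertices of type \<^typ>\<open>nat\<close>.\<close>

definition graph_family :: "nat \<Rightarrow> nat graph set \<Rightarrow> bool" where
  "graph_family r F \<longleftrightarrow>
     (\<forall>G\<in>F. simple_graph G \<and> card (verts G) = r) \<and>
     (\<forall>G\<in>F. \<forall>G'::nat graph. simple_graph G' \<and> graph_iso G G' \<longrightarrow> G' \<in> F)"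

text \<open>Replacing \<open>x\<close> by a clone of \<open>y\<close>: the vertex name \<open>x\<close> is reused for the clone.\<close>

definition symmetrize :: "'a graph \<Rightarrow> 'a \<Rightarrow> 'a \<Rightarrow> 'a graph" where
  "symmetrize G x y =
     (verts G,
      {(u, v) \<in> edges G. u \<noteq> x \<and> v \<noteq> x} \<union>
      {(x, v) | v. v \<noteq> x \<and> (y, v) \<in> edges G} \<union>
      {(u, x) | u. u \<noteq> x \<and> (u, y) \<in> edges G})"

definition symmetrizable :: "'a graph set \<Rightarrow> bool" where
  "symmetrizable F \<longleftrightarrow>
     (\<forall>G\<in>F. \<forall>x\<in>verts G. \<forall>y\<in>verts G.
        x \<noteq> y \<and> (x, y) \<notin> edges G \<longrightarrow> symmetrize G x y \<in> F)"

definition iso_to_member :: "'a graph \<Rightarrow> 'b graph set \<Rightarrow> bool" where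
  "iso_to_member G F \<longleftrightarrow> (\<exists>G'\<in>F. graph_iso G G')"

definition induced_count :: "nat \<Rightarrow> nat graph set \<Rightarrow> 'a graph \<Rightarrow> nat" where
  "induced_count r F G =
     card {S. S \<subseteq> verts G \<and> card S = r \<and> iso_to_member (induced_subgraph G S) F}"

definition induced_frac :: "nat \<Rightarrow> nat graph set \<Rightarrow> 'a graph \<Rightarrow> real" where
  "induced_frac r F G = real (induced_count r F G) / real (card (verts G) choose r)"

definition max_induced_frac :: "'h graph \<Rightarrow> nat \<Rightarrow> nat graph set \<Rightarrow> nat \<Rightarrow> real" where
  "max_induced_frac H r F n =
     Max {induced_frac r F G | G::nat graph.
            simple_graph G \<and> card (verts G) = n \<and> \<not> contains_subgraph G H}"

definition inducibility :: "'h graph \<Rightarrow> nat \<Rightarrow> nat graph set \<Rightarrow> real" where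
  "inducibility H r F = lim (max_induced_frac H r F)"


section \<open>Complete multipartite graphons\<close>

definition part_interval :: "nat \<Rightarrow> (nat \<Rightarrow> real) \<Rightarrow> nat \<Rightarrow> real set" where
  "part_interval l x i =
     {(\<Sum>j<i. x j)..<(\<Sum>j<Suc i. x j)} \<union> (if Suc i = l then {1} else {})"

definition multipartite_graphon :: "nat \<Rightarrow> (nat \<Rightarrow> real) \<Rightarrow> real \<Rightarrow> real \<Rightarrow> real" where
  "multipartite_graphon l x s t =
     (if \<exists>i<l. \<exists>j<l. i \<noteq> j \<and> s \<in> part_interval l x i \<and> t \<in> part_interval l x j then 1 else 0)"

definition sampled_graph :: "nat \<Rightarrow> (real \<Rightarrow> real \<Rightarrow> real) \<Rightarrow> (nat \<Rightarrow> real) \<Rightarrow> nat graph" where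
  "sampled_graph r W \<omega> =
     ({..<r}, {(i, j). i < r \<and> j < r \<and> i \<noteq> j \<and> W (\<omega> i) (\<omega> j) = 1})"

definition graphon_induced_density ::
    "nat \<Rightarrow> nat graph set \<Rightarrow> (real \<Rightarrow> real \<Rightarrow> real) \<Rightarrow> real" where
  "graphon_induced_density r F W =
     \<P>(\<omega> in Pi\<^sub>M {..<r} (\<lambda>_. uniform_measure lborel {0..1}).
        iso_to_member (sampled_graph r W \<omega>) F)"


section \<open>Existence of the maximum and of the limit\<close>

lemma induced_count_le:
  assumes "finite (verts G)"
  shows "induced_count r F G \<le> card (verts G) choose r"
proof -
  have "induced_count r F G \<le> card {S. S \<subseteq> verts G \<and> card S = r}"
    unfolding induced_count_def using assms by (intro card_mono) auto
  also have "\<dots> = card (verts G) choose r"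
    using assms by (rule n_subsets)
  finally show ?thesis .
qed

lemma finite_induced_fracs:
  "finite {induced_frac r F G | G::nat graph.
     simple_graph G \<and> card (verts G) = n \<and> \<not> contains_subgraph G H}"
proof (rule finite_subset)
  show "{induced_frac r F G | G::nat graph.
      simple_graph G \<and> card (verts G) = n \<and> \<not> contains_subgraph G H}
    \<subseteq> (\<lambda>k. real k / real (n choose r)) ` {..n choose r}"
    using induced_count_le by (fastforce simp: induced_frac_def simple_graph_def)
qed simp

lemma edgeless_free:
  assumes "simple_graph H" "edges H \<noteq> {}"
  shows "\<exists>G::nat graph. simple_graph G \<and> card (verts G) = n \<and> \<not> contains_subgraph G H"
proof (intro exI conjI)
  let ?G = "({..<n}, {}) :: nat graph"
  show "simple_graph ?G" by (auto simp: simple_graph_def sym_def irrefl_def)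
  show "card (verts ?G) = n" by simp
  show "\<not> contains_subgraph ?G H"
    using assms by (force simp: contains_subgraph_def simple_graph_def)
qed

lemma max_induced_frac_attained:
  assumes "simple_graph H" "edges H \<noteq> {}"
  obtains G :: "nat graph" where "simple_graph G" "card (verts G) = n"
    "\<not> contains_subgraph G H" "max_induced_frac H r F n = induced_frac r F G"
proof -
  have "max_induced_frac H r F n \<in> {induced_frac r F G | G::nat graph.
      simple_graph G \<and> card (verts G) = n \<and> \<not> contains_subgraph G H}"
    unfolding max_induced_frac_def
    using edgeless_free[OF assms, of n] by (intro Max_in finite_induced_fracs) blast
  thus ?thesis using that by blast
qed

lemma max_induced_frac_upper:
  fixes G :: "nat graph"
  assumes "simple_graph G" "\<not> contains_subgraph G H"
  shows "induced_frac r F G \<le> max_induced_frac H r F (card (verts G))"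
  unfolding max_induced_frac_def
  using assms by (intro Max_ge finite_induced_fracs) blast

lemma max_induced_frac_nonneg:
  assumes "simple_graph H" "edges H \<noteq> {}"
  shows "0 \<le> max_induced_frac H r F n"
  by (rule max_induced_frac_attained[OF assms, of n r F]) (simp add: induced_frac_def)

lemma sum_induced_count_delete:
  assumes "finite (verts G)"
  shows "(\<Sum>v\<in>verts G. induced_count r F (induced_subgraph G (verts G - {v})))
       = (card (verts G) - r) * induced_count r F G"
proof -
  let ?T = "{S. S \<subseteq> verts G \<and> card S = r \<and> iso_to_member (induced_subgraph G S) F}"
  have fin: "finite ?T" using assms by simp
  have ind: "induced_subgraph (induced_subgraph G (verts G - {v})) S = induced_subgraph G S"
    if "S \<subseteq> verts G - {v}" for S v
    using that by (auto simp: induced_subgraph_def)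
  have 1: "induced_count r F (induced_subgraph G (verts G - {v})) = card {S \<in> ?T. v \<notin> S}" for v
  proof -
    have "{S. S \<subseteq> verts G - {v} \<and> card S = r \<and>
        iso_to_member (induced_subgraph (induced_subgraph G (verts G - {v})) S) F}
      = {S \<in> ?T. v \<notin> S}"
      by (rule set_eqI) (use ind[of _ v] in \<open>simp add: subset_Diff_insert conj_commute conj_left_commute cong: conj_cong\<close>)
    thus ?thesis by (simp add: induced_count_def) (simp add: induced_subgraph_def)
  qed
  have 2: "\<forall>S\<in>?T. card {v \<in> verts G. v \<notin> S} = card (verts G) - r"
  proof
    fix S assume "S \<in> ?T"
    hence S: "S \<subseteq> verts G" "card S = r" by auto
    have "{v \<in> verts G. v \<notin> S} = verts G - S" by auto
    thus "card {v \<in> verts G. v \<notin> S} = card (verts G) - r"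
      using S assms by (simp add: card_Diff_subset finite_subset)
  qed
  show ?thesis
    unfolding 1 using sum_multicount[OF assms fin 2] by (simp add: induced_count_def)
qed

lemma max_induced_frac_Suc_le:
  assumes H: "simple_graph H" "edges H \<noteq> {}" and "r \<le> n"
  shows "max_induced_frac H r F (Suc n) \<le> max_induced_frac H r F n"
proof -
  obtain G :: "nat graph" where G: "simple_graph G" "card (verts G) = Suc n"
      "\<not> contains_subgraph G H" "max_induced_frac H r F (Suc n) = induced_frac r F G"
    by (rule max_induced_frac_attained[OF H])
  have fin: "finite (verts G)" using G(1) by (simp add: simple_graph_def)
  let ?M = "max_induced_frac H r F n"
  have le: "real (induced_count r F (induced_subgraph G (verts G - {v}))) \<le> ?M * real (n choose r)"
    if v: "v \<in> verts G" for v
  proof -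
    let ?G' = "induced_subgraph G (verts G - {v})"
    have s: "simple_graph ?G'"
      using G(1) by (auto simp: simple_graph_def induced_subgraph_def sym_def irrefl_def)
    have c: "card (verts ?G') = n"
      using v G(2) fin by (simp add: induced_subgraph_def)
    have "\<not> contains_subgraph ?G' H"
      using G(3) unfolding contains_subgraph_def induced_subgraph_def by fastforce
    from max_induced_frac_upper[OF s this, of r F] c
    have "induced_frac r F ?G' \<le> ?M" by simp
    thus ?thesis
      using \<open>r \<le> n\<close> unfolding induced_frac_def c by (simp add: field_simps)
  qed
  have "real (Suc n - r) * real (induced_count r F G)
      = (\<Sum>v\<in>verts G. real (induced_count r F (induced_subgraph G (verts G - {v}))))"
    using sum_induced_count_delete[OF fin, of r F] G(2)
    by (metis of_nat_mult of_nat_sum)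
  also have "\<dots> \<le> (\<Sum>v\<in>verts G. ?M * real (n choose r))"
    by (intro sum_mono le)
  also have "\<dots> = ?M * real (Suc n * (n choose r))"
    using G(2) by (simp add: algebra_simps)
  also have "Suc n * (n choose r) = (Suc n - r) * (Suc n choose r)"
    using binomial_absorb_comp[of "Suc n" r] by simp
  finally have "real (Suc n - r) * real (induced_count r F G)
      \<le> real (Suc n - r) * (?M * real (Suc n choose r))"
    by (simp add: mult_ac)
  hence "real (induced_count r F G) \<le> ?M * real (Suc n choose r)"
    using \<open>r \<le> n\<close> by (subst (asm) mult_le_cancel_left_pos) auto
  moreover have "real (Suc n choose r) > 0"
    using \<open>r \<le> n\<close> by simp
  ultimately show ?thesis
    unfolding G(4) induced_frac_def G(2) by (simp add: pos_divide_le_eq)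
qed

lemma max_induced_frac_convergent:
  assumes H: "simple_graph H" "edges H \<noteq> {}"
  shows "convergent (max_induced_frac H r F)"
proof -
  have "decseq (\<lambda>n. max_induced_frac H r F (n + r))"
    by (rule decseq_SucI) (use max_induced_frac_Suc_le[OF H] in simp)
  moreover have "\<forall>n. 0 \<le> max_induced_frac H r F (n + r)"
    using max_induced_frac_nonneg[OF H] by simp
  ultimately obtain L where "(\<lambda>n. max_induced_frac H r F (n + r)) \<longlonglongrightarrow> L"
    by (rule decseq_convergent)
  hence "max_induced_frac H r F \<longlonglongrightarrow> L" by (rule LIMSEQ_offset)
  thus ?thesis by (rule convergentI)
qed

lemma edges_nonempty_if_chromatic_number_ge_2:
  assumes "chromatic_number H \<ge> 2"
  shows "edges H \<noteq> {}"
proof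
  assume "edges H = {}"
  hence "proper_colouring H 1 (\<lambda>_. 0)" by (simp add: proper_colouring_def)
  hence "chromatic_number H \<le> 1"
    unfolding chromatic_number_def by (intro Least_le) blast
  thus False using assms by simp
qed

end

theory Submission
  imports Defs
begin

text \<open>
  Let \<open>k\<close> be the chromatic number of \<open>H\<close>.  The theorem compares the \<open>H\<close>-free graphs with the
  graphs that contain no complete graph \<open>K\<^sub>k\<close> on \<open>k\<close> vertices; random sampling takes the place of
  the graph removal lemma.

  Lower bound and shape of the extremal graphs.  Let \<open>x\<close>, \<open>y\<close> be nonadjacent.  Cloning \<open>y\<close> over
  \<open>x\<close> keeps every copy of \<open>F\<close> that contains both (this is symmetrizability), drops the copies
  that use only \<open>x\<close>, and duplicates those that use only \<open>y\<close>.  Hence the two possible clonings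
  together have at least twice as many copies as the original graph
  (\<open>induced_count_symmetrize_both\<close>), and both preserve the absence of \<open>K\<^sub>k\<close>.  Consequently, among the
  \<open>K\<^sub>k\<close>-free graphs with the most copies, one with the most pairs of twins has only twins as
  nonadjacent pairs, that is, it is complete multipartite with at most \<open>k - 1\<close> parts
  (\<open>multipartite_maximizer\<close>).  Such a graph is \<open>(k - 1)\<close>-colourable, so it contains no \<open>H\<close>, and the
  maximum over \<open>H\<close>-free graphs is at least the maximum over \<open>K\<^sub>k\<close>-free ones.

  Upper bound.  An \<open>H\<close>-free graph has a vanishing density of \<open>k\<close>-cliques as its order grows:
  by Cauchy-Schwarz, cloning a vertex of a pattern leaves at least the square of its homomorphism
  density, so many \<open>k\<close>-cliques would force many homomorphisms from a blow-up containing \<open>H\<close>, one of them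
  injective.  A random vertex set of fixed size \<open>m\<close> is therefore \<open>K\<^sub>k\<close>-free with probability
  tending to 1, while its expected density of \<open>F\<close> equals that of the whole graph.  So the
  inducibility with respect to \<open>H\<close> is at most the \<open>K\<^sub>k\<close>-free maximum on \<open>m\<close> vertices, for every
  large \<open>m\<close> (\<open>inducibility_le_complete\<close>).

  Attainment.  The density of \<open>F\<close> in a complete multipartite graph is, up to an error caused by
  non-injective samples, a fixed polynomial in the part proportions
  (\<open>induced_frac_multipartite_approx\<close>), and the same polynomial is the density of \<open>F\<close> in the
  corresponding graphon (\<open>graphon_density_multipartite\<close>).  A convergent subsequence of the
  proportions of extremal graphs gives the graphon, once parts of measure zero are dropped.
\<close>

section \<open>Isomorphism, cliques and density\<close>

lemma simple_graph_induced:
  assumes "simple_graph G" "S \<subseteq> verts G"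
  shows "simple_graph (induced_subgraph G S)"
  using assms
  by (auto simp: simple_graph_def induced_subgraph_def sym_def irrefl_def finite_subset)

lemma graph_iso_refl: "graph_iso G G"
  unfolding graph_iso_def by (intro exI[of _ id]) auto

lemma graph_iso_sym:
  assumes "graph_iso G G'" shows "graph_iso G' G"
proof -
  obtain f where f: "bij_betw f (verts G) (verts G')"
    "\<And>u v. u \<in> verts G \<Longrightarrow> v \<in> verts G \<Longrightarrow> (u, v) \<in> edges G \<longleftrightarrow> (f u, f v) \<in> edges G'"
    using assms unfolding graph_iso_def by blast
  let ?g = "the_inv_into (verts G) f"
  have g: "bij_betw ?g (verts G') (verts G)" by (rule bij_betw_the_inv_into[OF f(1)])
  have "(u, v) \<in> edges G' \<longleftrightarrow> (?g u, ?g v) \<in> edges G" if "u \<in> verts G'" "v \<in> verts G'" for u v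
    using f(2)[of "?g u" "?g v"] that bij_betwE[OF g] f_the_inv_into_f_bij_betw[OF f(1)]
    by auto
  with g show ?thesis unfolding graph_iso_def by blast
qed

lemma graph_iso_trans:
  assumes "graph_iso G G'" "graph_iso G' G''" shows "graph_iso G G''"
proof -
  obtain f where f: "bij_betw f (verts G) (verts G')"
    "\<And>u v. u \<in> verts G \<Longrightarrow> v \<in> verts G \<Longrightarrow> (u, v) \<in> edges G \<longleftrightarrow> (f u, f v) \<in> edges G'"
    using assms(1) unfolding graph_iso_def by blast
  obtain g where g: "bij_betw g (verts G') (verts G'')"
    "\<And>u v. u \<in> verts G' \<Longrightarrow> v \<in> verts G' \<Longrightarrow> (u, v) \<in> edges G' \<longleftrightarrow> (g u, g v) \<in> edges G''"
    using assms(2) unfolding graph_iso_def by blast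
  have "(u, v) \<in> edges G \<longleftrightarrow> ((g \<circ> f) u, (g \<circ> f) v) \<in> edges G''"
    if "u \<in> verts G" "v \<in> verts G" for u v
    using f(2)[OF that] g(2)[of "f u" "f v"] that bij_betwE[OF f(1)] by simp
  with bij_betw_trans[OF f(1) g(1)] show ?thesis unfolding graph_iso_def
    by (intro exI[of _ "g \<circ> f"] conjI ballI)
qed

lemma iso_to_member_cong:
  assumes "graph_iso G G'" shows "iso_to_member G F \<longleftrightarrow> iso_to_member G' F"
  using graph_iso_trans[OF assms] graph_iso_trans[OF graph_iso_sym[OF assms]]
  unfolding iso_to_member_def by blast

lemma iso_to_member_iff_mem:
  fixes G :: "nat graph"
  assumes "graph_family r F" "simple_graph G"
  shows "iso_to_member G F \<longleftrightarrow> G \<in> F"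
proof
  assume "iso_to_member G F"
  then obtain G' where "G' \<in> F" "graph_iso G G'" by (auto simp: iso_to_member_def)
  thus "G \<in> F" using assms graph_iso_sym[of G G'] unfolding graph_family_def by blast
next
  assume "G \<in> F"
  thus "iso_to_member G F" using graph_iso_refl[of G] unfolding iso_to_member_def by blast
qed

text \<open>An embedding of a complete graph is the same as a family of pairwise adjacent vertices:
  as there are no loops, injectivity is automatic.  This is what makes cliques behave well under
  maps that only preserve adjacency.\<close>

lemma contains_complete_iff:
  assumes "simple_graph G"
  shows "contains_subgraph G (complete_nat_graph k) \<longleftrightarrow>
    (\<exists>f. \<forall>i<k. f i \<in> verts G \<and> (\<forall>j<k. i \<noteq> j \<longrightarrow> (f i, f j) \<in> edges G))" (is "?L \<longleftrightarrow> ?R")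
proof
  assume ?L
  then obtain f where "f ` {..<k} \<subseteq> verts G" "\<forall>i<k. \<forall>j<k. i \<noteq> j \<longrightarrow> (f i, f j) \<in> edges G"
    unfolding contains_subgraph_def complete_nat_graph_def by auto
  thus ?R by blast
next
  assume ?R
  then obtain f where f: "\<forall>i<k. f i \<in> verts G \<and> (\<forall>j<k. i \<noteq> j \<longrightarrow> (f i, f j) \<in> edges G)" by blast
  have "inj_on f {..<k}"
  proof (rule inj_onI)
    fix i j assume "i \<in> {..<k}" "j \<in> {..<k}" "f i = f j"
    thus "i = j" using f assms unfolding simple_graph_def irrefl_def by (metis lessThan_iff)
  qed
  thus ?L using f unfolding contains_subgraph_def complete_nat_graph_def
    by (intro exI[of _ f]) auto
qed

lemma simple_complete_nat_graph: "simple_graph (complete_nat_graph k)"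
  by (auto simp: simple_graph_def complete_nat_graph_def sym_def irrefl_def)

lemma edges_complete_nat_graph_nonempty:
  assumes "k \<ge> 2" shows "edges (complete_nat_graph k) \<noteq> {}"
proof -
  have "(0, 1) \<in> edges (complete_nat_graph k)" using assms by (simp add: complete_nat_graph_def)
  thus ?thesis by blast
qed

lemma induced_frac_le_1:
  assumes "finite (verts G)" shows "induced_frac r F G \<le> 1"
  using induced_count_le[OF assms, of r F] unfolding induced_frac_def
  by (simp add: divide_le_eq)

lemma induced_frac_nonneg: "0 \<le> induced_frac r F G"
  by (simp add: induced_frac_def)

lemma max_induced_frac_tendsto_inducibility:
  assumes "simple_graph H" "edges H \<noteq> {}"
  shows "max_induced_frac H r F \<longlonglongrightarrow> inducibility H r F"
  using max_induced_frac_convergent[OF assms] unfolding inducibility_def convergent_LIMSEQ_iff .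

section \<open>Symmetrization\<close>

lemma simple_symmetrize:
  assumes "simple_graph G" "x \<in> verts G"
  shows "simple_graph (symmetrize G x y)"
  using assms unfolding simple_graph_def symmetrize_def sym_def irrefl_def by fastforce

text \<open>Sending \<open>x\<close> to \<open>y\<close> maps the symmetrized graph homomorphically into the original one, and
  a homomorphism takes cliques to cliques.\<close>

lemma complete_free_symmetrize:
  assumes G: "simple_graph G" "x \<in> verts G" "y \<in> verts G"
    and free: "\<not> contains_subgraph G (complete_nat_graph k)"
  shows "\<not> contains_subgraph (symmetrize G x y) (complete_nat_graph k)"
proof
  assume "contains_subgraph (symmetrize G x y) (complete_nat_graph k)"
  then obtain f where f: "\<forall>i<k. f i \<in> verts G \<and>
      (\<forall>j<k. i \<noteq> j \<longrightarrow> (f i, f j) \<in> edges (symmetrize G x y))"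
    unfolding contains_complete_iff[OF simple_symmetrize[OF G(1,2)]]
    by (auto simp: symmetrize_def)
  let ?p = "\<lambda>v. if v = x then y else v"
  have hom: "(?p u, ?p v) \<in> edges G" if "(u, v) \<in> edges (symmetrize G x y)" for u v
    using that by (auto simp: symmetrize_def)
  have "\<forall>i<k. ?p (f i) \<in> verts G \<and> (\<forall>j<k. i \<noteq> j \<longrightarrow> (?p (f i), ?p (f j)) \<in> edges G)"
    using f hom G(3) by simp
  hence "contains_subgraph G (complete_nat_graph k)"
    unfolding contains_complete_iff[OF G(1)] by (intro exI[of _ "\<lambda>i. ?p (f i)"])
  with free show False ..
qed

lemma induced_symmetrize:
  assumes "x \<in> S" "y \<in> S"
  shows "induced_subgraph (symmetrize G x y) S = symmetrize (induced_subgraph G S) x y"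
  using assms by (auto simp: induced_subgraph_def symmetrize_def)

lemma induced_symmetrize_notin:
  assumes "x \<notin> S"
  shows "induced_subgraph (symmetrize G x y) S = induced_subgraph G S"
  using assms by (auto simp: induced_subgraph_def symmetrize_def)

lemma induced_symmetrize_swap:
  assumes G: "simple_graph G" and S: "x \<notin> S" "y \<in> S"
  shows "graph_iso (induced_subgraph G S)
           (induced_subgraph (symmetrize G x y) (insert x (S - {y})))"
proof -
  let ?f = "\<lambda>v. if v = y then x else v"
  have loop: "(y, y) \<notin> edges G" using G by (auto simp: simple_graph_def irrefl_def)
  have "bij_betw ?f S (insert x (S - {y}))"
    using S by (auto simp: bij_betw_def inj_on_def)
  moreover have "(u, v) \<in> edges G \<longleftrightarrow> (?f u, ?f v) \<in> edges (symmetrize G x y)"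
    if "u \<in> S" "v \<in> S" for u v
    using that S loop by (auto simp: symmetrize_def)
  moreover have "?f u \<in> insert x (S - {y})" if "u \<in> S" for u using that by auto
  ultimately show ?thesis unfolding graph_iso_def
    by (intro exI[of _ ?f]) (simp add: induced_subgraph_def)
qed

text \<open>The three terms are the vertex sets that avoid \<open>x\<close> and \<open>y\<close> (their induced graph does not
  change), those that contain \<open>y\<close> only (they survive, and so does their image under exchanging
  \<open>y\<close> for its clone), and those that contain both (they survive by symmetrizability).\<close>

lemma induced_count_symmetrize_ge:
  fixes G :: "nat graph"
  assumes F: "graph_family r F" "symmetrizable F"
    and G: "simple_graph G" and xy: "x \<in> verts G" "y \<in> verts G" "x \<noteq> y" "(x, y) \<notin> edges G"
  defines "T \<equiv> {S. S \<subseteq> verts G \<and> card S = r \<and> iso_to_member (induced_subgraph G S) F}"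
  shows "induced_count r F (symmetrize G x y) \<ge>
    card {S\<in>T. x \<notin> S \<and> y \<notin> S} + 2 * card {S\<in>T. x \<notin> S \<and> y \<in> S} + card {S\<in>T. x \<in> S \<and> y \<in> S}"
proof -
  let ?G' = "symmetrize G x y"
  let ?T' = "{S. S \<subseteq> verts ?G' \<and> card S = r \<and> iso_to_member (induced_subgraph ?G' S) F}"
  let ?sw = "\<lambda>S. insert x (S - {y})"
  let ?A = "{S\<in>T. x \<notin> S \<and> y \<notin> S}" and ?B = "{S\<in>T. x \<notin> S \<and> y \<in> S}"
    and ?C = "{S\<in>T. x \<in> S \<and> y \<in> S}"
  have V: "verts ?G' = verts G" by (simp add: symmetrize_def)
  have finV: "finite (verts G)" using G by (simp add: simple_graph_def)
  have finT: "finite T" using finV by (simp add: T_def)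
  have finT': "finite ?T'" using finV V by simp
  have 1: "?A \<union> ?B \<subseteq> ?T'"
    using V by (auto simp: T_def induced_symmetrize_notin)
  have 2: "?C \<subseteq> ?T'"
  proof
    fix S assume "S \<in> ?C"
    hence S: "S \<subseteq> verts G" "card S = r" "iso_to_member (induced_subgraph G S) F" "x \<in> S" "y \<in> S"
      by (auto simp: T_def)
    have "induced_subgraph G S \<in> F"
      using S iso_to_member_iff_mem[OF F(1) simple_graph_induced[OF G S(1)]] by simp
    hence "symmetrize (induced_subgraph G S) x y \<in> F"
      using F(2) S xy unfolding symmetrizable_def by (auto simp: induced_subgraph_def)
    hence "iso_to_member (induced_subgraph ?G' S) F"
      unfolding induced_symmetrize[OF S(4,5)] iso_to_member_def using graph_iso_refl by blast
    thus "S \<in> ?T'" using S V by simp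
  qed
  have 3: "?sw ` ?B \<subseteq> ?T'"
  proof
    fix S' assume "S' \<in> ?sw ` ?B"
    then obtain S where S: "S' = ?sw S" "S \<subseteq> verts G" "card S = r"
        "iso_to_member (induced_subgraph G S) F" "x \<notin> S" "y \<in> S"
      by (auto simp: T_def)
    have fin: "finite S" using S(2) finV finite_subset by blast
    have "card S' = r"
      using S fin card_Suc_Diff1[OF fin S(6)] by simp
    moreover have "iso_to_member (induced_subgraph ?G' S') F"
      using iso_to_member_cong[OF induced_symmetrize_swap[OF G S(5,6)]] S by blast
    ultimately show "S' \<in> ?T'" using S V xy by auto
  qed
  have inj: "inj_on ?sw ?B"
  proof (rule inj_on_inverseI)
    fix S assume "S \<in> ?B"
    thus "insert y (?sw S - {x}) = S" using xy(3) by auto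
  qed
  have "card ?A + 2 * card ?B + card ?C = card ?A + card ?B + card (?sw ` ?B) + card ?C"
    by (simp add: card_image[OF inj])
  also have "\<dots> = card (?A \<union> ?B \<union> ?sw ` ?B \<union> ?C)"
  proof -
    have fin: "finite ?A" "finite ?B" "finite ?C" "finite (?sw ` ?B)" using finT by auto
    have "card (?A \<union> ?B \<union> ?sw ` ?B \<union> ?C) = card (?A \<union> ?B \<union> ?sw ` ?B) + card ?C"
      using fin xy(3) by (intro card_Un_disjoint) auto
    also have "card (?A \<union> ?B \<union> ?sw ` ?B) = card (?A \<union> ?B) + card (?sw ` ?B)"
      using fin xy(3) by (intro card_Un_disjoint) auto
    also have "card (?A \<union> ?B) = card ?A + card ?B"
      using fin by (intro card_Un_disjoint) auto
    finally show ?thesis by simp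
  qed
  also have "\<dots> \<le> card ?T'"
    using 1 2 3 by (intro card_mono finT') blast
  finally show ?thesis by (simp add: induced_count_def)
qed

lemma induced_count_symmetrize_both:
  fixes G :: "nat graph"
  assumes F: "graph_family r F" "symmetrizable F"
    and G: "simple_graph G" and xy: "x \<in> verts G" "y \<in> verts G" "x \<noteq> y" "(x, y) \<notin> edges G"
  shows "2 * induced_count r F G \<le>
    induced_count r F (symmetrize G x y) + induced_count r F (symmetrize G y x)"
proof -
  let ?T = "{S. S \<subseteq> verts G \<and> card S = r \<and> iso_to_member (induced_subgraph G S) F}"
  let ?N = "\<lambda>P. card {S\<in>?T. P S}"
  have fin: "finite ?T" using G by (simp add: simple_graph_def)
  have split: "?N P = ?N (\<lambda>S. P S \<and> Q S) + ?N (\<lambda>S. P S \<and> \<not> Q S)" for P Q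
  proof -
    have eq: "{S\<in>?T. P S} = {S\<in>?T. P S \<and> Q S} \<union> {S\<in>?T. P S \<and> \<not> Q S}" by blast
    show ?thesis by (subst eq, intro card_Un_disjoint finite_subset[OF _ fin]) auto
  qed
  have yx: "(y, x) \<notin> edges G" using xy G by (auto simp: simple_graph_def sym_def)
  have "induced_count r F G = ?N (\<lambda>S. True)" by (simp add: induced_count_def)
  also have "\<dots> = ?N (\<lambda>S. x \<in> S \<and> y \<in> S) + ?N (\<lambda>S. x \<in> S \<and> y \<notin> S)
      + (?N (\<lambda>S. x \<notin> S \<and> y \<in> S) + ?N (\<lambda>S. x \<notin> S \<and> y \<notin> S))"
    using split[of "\<lambda>_. True" "\<lambda>S. x \<in> S"] split[of "\<lambda>S. x \<in> S" "\<lambda>S. y \<in> S"]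
      split[of "\<lambda>S. x \<notin> S" "\<lambda>S. y \<in> S"] by simp
  finally show ?thesis
    using induced_count_symmetrize_ge[OF F G xy]
      induced_count_symmetrize_ge[OF F G xy(2,1) xy(3)[symmetric] yx]
    by (simp add: conj_commute)
qed

text \<open>The number of these pairs is the sum of the squared sizes of the twin classes, a potential
  that grows when a class loses a vertex to one that is at least as large.\<close>

definition twin_pairs :: "'a graph \<Rightarrow> ('a \<times> 'a) set" where
  "twin_pairs G = {(u, v) \<in> verts G \<times> verts G. edges G `` {u} = edges G `` {v}}"

text \<open>Moving \<open>x\<close> from a twin class of size \<open>a\<close> to one of size \<open>b \<ge> a\<close> changes \<open>a\<^sup>2 + b\<^sup>2\<close> into
  \<open>(a - 1)\<^sup>2 + (b + 1)\<^sup>2\<close>, a strict gain; twins other than \<open>x\<close> stay twins, because they agree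
  on adjacency to \<open>y\<close> and hence to the clone.\<close>

lemma card_twin_pairs_symmetrize:
  assumes G: "simple_graph G" and xy: "x \<in> verts G" "y \<in> verts G" "(x, y) \<notin> edges G"
    and ne: "edges G `` {x} \<noteq> edges G `` {y}"
    and le: "card {v \<in> verts G. edges G `` {v} = edges G `` {x}}
           \<le> card {v \<in> verts G. edges G `` {v} = edges G `` {y}}"
  shows "card (twin_pairs G) < card (twin_pairs (symmetrize G x y))"
proof -
  let ?N = "\<lambda>v. edges G `` {v}" and ?N' = "\<lambda>v. edges (symmetrize G x y) `` {v}"
  define A where "A = {v \<in> verts G. ?N v = ?N x}"
  define B where "B = {v \<in> verts G. ?N v = ?N y}"
  define T0 where "T0 = twin_pairs G \<inter> (- {x}) \<times> (- {x})"
  have fin: "finite (verts G)" and sy: "sym (edges G)" and loop: "\<And>v. (v, v) \<notin> edges G"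
    using G by (auto simp: simple_graph_def irrefl_def)
  have V: "verts (symmetrize G x y) = verts G" by (simp add: symmetrize_def)
  have finT: "finite T0" "finite A" "finite B" "finite (twin_pairs (symmetrize G x y))"
    using fin V unfolding T0_def twin_pairs_def A_def B_def
    by (auto intro: finite_subset[of _ "verts G \<times> verts G"])
  have Nx: "?N' x = ?N y" using xy sy unfolding symmetrize_def sym_def by auto
  have Nv: "?N' v = (?N v - {x}) \<union> (if y \<in> ?N v then {x} else {})" if "v \<noteq> x" for v
    using that by (auto simp: symmetrize_def)
  have NB: "?N' v = ?N' x" if "v \<in> B" for v
  proof -
    have v: "v \<noteq> x" "?N v = ?N y" using that ne by (auto simp: B_def)
    have "y \<notin> ?N v" "x \<notin> ?N v" using v loop xy sy by (auto simp: sym_def)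
    thus ?thesis using Nv[OF v(1)] Nx v(2) by auto
  qed
  have xB: "x \<notin> B" "x \<in> A" using ne xy by (auto simp: A_def B_def)
  have "twin_pairs G \<subseteq> T0 \<union> {x} \<times> A \<union> (A - {x}) \<times> {x}"
    by (auto simp: T0_def A_def twin_pairs_def)
  hence "card (twin_pairs G) \<le> card (T0 \<union> {x} \<times> A \<union> (A - {x}) \<times> {x})"
    using finT by (intro card_mono) auto
  also have "\<dots> \<le> card T0 + card A + (card A - 1)"
    using finT xB by (intro order_trans[OF card_Un_le] add_mono)
      (auto simp: card_cartesian_product card_Diff_singleton intro: order_trans[OF card_Un_le])
  also have "\<dots> < card T0 + Suc (card B) + card B"
    using le unfolding A_def B_def by linarith
  also have "\<dots> = card (T0 \<union> {x} \<times> insert x B \<union> B \<times> {x})"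
  proof -
    have "card (T0 \<union> {x} \<times> insert x B \<union> B \<times> {x}) = card (T0 \<union> {x} \<times> insert x B) + card (B \<times> {x})"
      using finT xB by (intro card_Un_disjoint) (auto simp: T0_def)
    also have "card (T0 \<union> {x} \<times> insert x B) = card T0 + card ({x} \<times> insert x B)"
      using finT xB by (intro card_Un_disjoint) (auto simp: T0_def)
    finally show ?thesis using finT xB by (simp add: card_cartesian_product)
  qed
  also have "\<dots> \<le> card (twin_pairs (symmetrize G x y))"
  proof (intro card_mono finT(4))
    have "?N' u = ?N' v" if "(u, v) \<in> T0" for u v
      using that Nv[of u] Nv[of v] by (auto simp: T0_def twin_pairs_def)
    moreover have "T0 \<subseteq> verts G \<times> verts G" "B \<subseteq> verts G"
      by (auto simp: T0_def B_def twin_pairs_def)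
    ultimately show "T0 \<union> {x} \<times> insert x B \<union> B \<times> {x} \<subseteq> twin_pairs (symmetrize G x y)"
      using NB xy(1) unfolding twin_pairs_def V by blast
  qed
  finally show ?thesis .
qed

text \<open>The colour classes are the parts of a complete multipartite graph; empty classes are
  permitted, so that \<open>l\<close> bounds the number of parts from above.\<close>

definition partition_colouring :: "'a graph \<Rightarrow> nat \<Rightarrow> ('a \<Rightarrow> nat) \<Rightarrow> bool" where
  "partition_colouring G l c \<longleftrightarrow> (\<forall>v\<in>verts G. c v < l) \<and>
     (\<forall>u\<in>verts G. \<forall>v\<in>verts G. (u, v) \<in> edges G \<longleftrightarrow> c u \<noteq> c v)"

text \<open>If nonadjacent vertices are twins, nonadjacency means equality of neighbourhoods and so is
  an equivalence relation.  Representatives of its classes form a clique, which bounds their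
  number.\<close>

lemma partition_colouring_if_nonadjacent_twins:
  assumes G: "simple_graph G"
    and twins: "\<And>u v. u \<in> verts G \<Longrightarrow> v \<in> verts G \<Longrightarrow> (u, v) \<notin> edges G \<Longrightarrow>
      edges G `` {u} = edges G `` {v}"
    and free: "\<not> contains_subgraph G (complete_nat_graph (Suc l))"
  obtains c where "partition_colouring G l c"
proof -
  let ?N = "\<lambda>v. edges G `` {v}"
  have fin: "finite (verts G)" using G by (simp add: simple_graph_def)
  have adj: "(u, v) \<in> edges G \<longleftrightarrow> ?N u \<noteq> ?N v" if "u \<in> verts G" "v \<in> verts G" for u v
    using twins[OF that] G by (auto simp: simple_graph_def irrefl_def)
  have "card (?N ` verts G) \<le> l"
  proof (rule ccontr)
    assume "\<not> ?thesis"
    hence "card {..<Suc l} \<le> card (?N ` verts G)" by simp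
    then obtain g where g: "inj_on g {..<Suc l}" "g ` {..<Suc l} \<subseteq> ?N ` verts G"
      using inj_on_iff_card_le[of "{..<Suc l}" "?N ` verts G"] fin by auto
    hence "\<forall>i<Suc l. \<exists>v\<in>verts G. ?N v = g i" by (force simp: image_subset_iff)
    then obtain f where f: "\<And>i. i < Suc l \<Longrightarrow> f i \<in> verts G \<and> ?N (f i) = g i" by metis
    have "(f i, f j) \<in> edges G" if "i < Suc l" "j < Suc l" "i \<noteq> j" for i j
      using f[OF that(1)] f[OF that(2)] adj that g(1) by (auto simp: inj_on_def)
    hence "contains_subgraph G (complete_nat_graph (Suc l))"
      unfolding contains_complete_iff[OF G] using f by blast
    with free show False ..
  qed
  hence "card (?N ` verts G) \<le> card {..<l}" by simp
  then obtain g where g: "inj_on g (?N ` verts G)" "g ` (?N ` verts G) \<subseteq> {..<l}"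
    using inj_on_iff_card_le[of "?N ` verts G" "{..<l}"] fin by auto
  have "partition_colouring G l (\<lambda>v. g (?N v))"
    unfolding partition_colouring_def using g adj by (auto simp: inj_on_def image_subset_iff)
  thus ?thesis by (rule that)
qed

text \<open>Since the two symmetrizations of a maximizer average at least as much as the maximizer and
  both are admissible, both are again maximizers.  Hence choosing a maximizer with the most pairs
  of twins leaves no nonadjacent pair with distinct neighbourhoods.\<close>

lemma multipartite_maximizer:
  assumes F: "graph_family r F" "symmetrizable F" and l: "l \<ge> 1"
  obtains G :: "nat graph" and c where "simple_graph G" "card (verts G) = n"
    "partition_colouring G l c"
    "max_induced_frac (complete_nat_graph (Suc l)) r F n = induced_frac r F G"
proof -
  let ?K = "complete_nat_graph (Suc l)"
  let ?M = "max_induced_frac ?K r F n"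
  \<comment> \<open>The vertex names range over an infinite type, so the second maximization is over an infinite
    set, but the number of pairs of twins is at most \<open>n * n\<close>.\<close>
  define P where "P G \<longleftrightarrow> simple_graph G \<and> card (verts G) = n \<and> \<not> contains_subgraph G ?K \<and>
    induced_frac r F G = ?M" for G :: "nat graph"
  have "2 \<le> Suc l" using l by simp
  then obtain G0 :: "nat graph" where "simple_graph G0" "card (verts G0) = n"
      "\<not> contains_subgraph G0 ?K" "?M = induced_frac r F G0"
    by (rule max_induced_frac_attained[OF simple_complete_nat_graph edges_complete_nat_graph_nonempty])
  hence "P G0" by (simp add: P_def)
  moreover have "\<forall>G. P G \<longrightarrow> card (twin_pairs G) < Suc (n * n)"
  proof (intro allI impI)
    fix G assume "P G"
    hence G: "finite (verts G)" "card (verts G) = n" by (auto simp: P_def simple_graph_def)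
    have "card (twin_pairs G) \<le> card (verts G \<times> verts G)"
      using G by (intro card_mono) (auto simp: twin_pairs_def)
    thus "card (twin_pairs G) < Suc (n * n)" using G by (simp add: card_cartesian_product)
  qed
  ultimately obtain G where PG: "P G"
      and max: "\<And>G'. P G' \<Longrightarrow> card (twin_pairs G') \<le> card (twin_pairs G)"
    using ex_has_greatest_nat[of P G0 "\<lambda>G. card (twin_pairs G)"] by blast
  have G: "simple_graph G" "card (verts G) = n" "\<not> contains_subgraph G ?K" "induced_frac r F G = ?M"
    using PG by (auto simp: P_def)
  have P_sym: "P (symmetrize G x y)"
    if xy: "x \<in> verts G" "y \<in> verts G" "x \<noteq> y" "(x, y) \<notin> edges G" for x y
  proof -
    have V: "verts (symmetrize G x y) = verts G" "verts (symmetrize G y x) = verts G"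
      by (simp_all add: symmetrize_def)
    have s: "simple_graph (symmetrize G x y)" "simple_graph (symmetrize G y x)"
      using G xy by (auto intro: simple_symmetrize)
    have fr: "\<not> contains_subgraph (symmetrize G x y) ?K" "\<not> contains_subgraph (symmetrize G y x) ?K"
      using complete_free_symmetrize[OF G(1) xy(1,2) G(3)]
        complete_free_symmetrize[OF G(1) xy(2,1) G(3)] .
    have le: "induced_frac r F (symmetrize G x y) \<le> ?M" "induced_frac r F (symmetrize G y x) \<le> ?M"
      using max_induced_frac_upper[OF s(1) fr(1)] max_induced_frac_upper[OF s(2) fr(2)] V G by auto
    have "2 * real (induced_count r F G)
        \<le> real (induced_count r F (symmetrize G x y)) + real (induced_count r F (symmetrize G y x))"
      using induced_count_symmetrize_both[OF F G(1) xy]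
      by (metis of_nat_add of_nat_le_iff of_nat_mult of_nat_numeral)
    hence "2 * ?M \<le> induced_frac r F (symmetrize G x y) + induced_frac r F (symmetrize G y x)"
      unfolding G(4)[symmetric] induced_frac_def V
      by (simp add: add_divide_distrib[symmetric] divide_right_mono)
    thus ?thesis using le s fr V G unfolding P_def by auto
  qed
  have "edges G `` {x} = edges G `` {y}"
    if xy: "x \<in> verts G" "y \<in> verts G" "(x, y) \<notin> edges G" for x y
  proof (rule ccontr)
    assume ne: "edges G `` {x} \<noteq> edges G `` {y}"
    let ?cl = "\<lambda>x. card {v \<in> verts G. edges G `` {v} = edges G `` {x}}"
    have yx: "(y, x) \<notin> edges G" using xy G(1) by (auto simp: simple_graph_def sym_def)
    consider "?cl x \<le> ?cl y" | "?cl y \<le> ?cl x" by linarith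
    thus False
    proof cases
      case 1
      from card_twin_pairs_symmetrize[OF G(1) xy ne 1] max[OF P_sym[OF xy(1,2) _ xy(3)]] ne
      show False by auto
    next
      case 2
      from card_twin_pairs_symmetrize[OF G(1) xy(2,1) yx ne[symmetric] 2]
        max[OF P_sym[OF xy(2,1) _ yx]] ne
      show False by auto
    qed
  qed
  then obtain c where "partition_colouring G l c"
    using partition_colouring_if_nonadjacent_twins[OF G(1) _ G(3)] by blast
  thus ?thesis using that G by metis
qed

section \<open>The fraction of maps that are injective\<close>

text \<open>The probability that \<open>s\<close> vertices sampled with replacement from \<open>n\<close> are distinct.  For
  \<open>s > n\<close> the factor with \<open>i = n\<close> vanishes, so the product form needs no case distinction.\<close>

definition injective_fraction :: "nat \<Rightarrow> nat \<Rightarrow> real" where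
  "injective_fraction s n = (\<Prod>i<s. (real n - real i) / real n)"

lemma tendsto_injective_fraction: "injective_fraction s \<longlonglongrightarrow> 1"
proof -
  have "(\<lambda>n. \<Prod>i<s. (real n - real i) / real n) \<longlonglongrightarrow> (\<Prod>i<s. 1)"
    by (intro tendsto_prod) real_asymp
  thus ?thesis by (simp add: injective_fraction_def[abs_def])
qed

lemma card_injective_maps:
  assumes "finite U" "finite V" "card V > 0"
  shows "real (card {\<phi> \<in> U \<rightarrow>\<^sub>E V. inj_on \<phi> U}) =
    injective_fraction (card U) (card V) * real (card V) ^ card U"
proof -
  have "card {\<phi> \<in> U \<rightarrow>\<^sub>E V. inj_on \<phi> U} = (\<Prod>i<card U. card V - i)"
    using card_inj_on_subset_funcset[OF assms(1,2), of U] by (simp add: atLeast0LessThan)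
  also have "real \<dots> = (\<Prod>i<card U. real (card V) - real i)"
  proof (cases "card U \<le> card V")
    case True
    thus ?thesis by (auto intro!: prod.cong simp: of_nat_diff)
  next
    case False
    hence "card V \<in> {..<card U}" by simp
    have "(\<Prod>i<card U. card V - i) = 0"
      by (rule prod_zero) (use \<open>card V \<in> {..<card U}\<close> in \<open>auto intro!: bexI[of _ "card V"]\<close>)
    moreover have "(\<Prod>i<card U. real (card V) - real i) = 0"
      by (rule prod_zero) (use \<open>card V \<in> {..<card U}\<close> in \<open>auto intro!: bexI[of _ "card V"]\<close>)
    ultimately show ?thesis by (simp only: of_nat_0)
  qed
  also have "\<dots> = injective_fraction (card U) (card V) * real (card V) ^ card U"
    using assms(3) by (simp add: injective_fraction_def prod_dividef)
  finally show ?thesis .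
qed

lemma fact_mult_choose:
  assumes "n > 0"
  shows "fact r * real (n choose r) = injective_fraction r n * real n ^ r"
proof -
  have "fact r * real (n choose r) = (\<Prod>i<r. real n - real i)"
    unfolding binomial_gbinomial gbinomial_prod_rev by (simp add: atLeast0LessThan)
  thus ?thesis using assms by (simp add: injective_fraction_def prod_dividef)
qed

section \<open>Supersaturation\<close>

text \<open>Homomorphisms into \<open>G\<close> from the complete multipartite graph on \<open>U\<close> whose parts are the
  classes of \<open>c\<close>.  The identity colouring of \<open>{..<k}\<close> gives the ordered \<open>k\<close>-cliques.\<close>

definition coloured_homs :: "'a graph \<Rightarrow> ('u \<Rightarrow> nat) \<Rightarrow> 'u set \<Rightarrow> ('u \<Rightarrow> 'a) set" where
  "coloured_homs G c U =
     {\<phi> \<in> U \<rightarrow>\<^sub>E verts G. \<forall>u\<in>U. \<forall>v\<in>U. c u \<noteq> c v \<longrightarrow> (\<phi> u, \<phi> v) \<in> edges G}"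

definition coloured_hom_density :: "'a graph \<Rightarrow> ('u \<Rightarrow> nat) \<Rightarrow> 'u set \<Rightarrow> real" where
  "coloured_hom_density G c U = real (card (coloured_homs G c U)) / real (card (verts G)) ^ card U"

lemma finite_coloured_homs:
  assumes "finite (verts G)" "finite U" shows "finite (coloured_homs G c U)"
  unfolding coloured_homs_def using assms by (intro finite_subset[OF _ finite_PiE[of U "\<lambda>_. verts G"]]) auto

text \<open>Fix the images of all vertices but \<open>u\<close> by a map \<open>\<psi>\<close>, and let \<open>A \<psi>\<close> be the set of images
  still possible for \<open>u\<close>.  The homomorphisms number \<open>\<Sum>\<psi>. card (A \<psi>)\<close>; as the clone \<open>w\<close> is
  not adjacent to \<open>u\<close>, those of the larger pattern number at least \<open>\<Sum>\<psi>. (card (A \<psi>))\<^sup>2\<close>.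
  Cauchy-Schwarz compares the two sums.\<close>

lemma coloured_hom_density_clone:
  assumes V: "finite (verts G)" and U: "finite U" "u \<in> U" "w \<notin> U" "c w = c u"
  shows "(coloured_hom_density G c U)\<^sup>2 \<le> coloured_hom_density G c (insert w U)"
proof -
  let ?X = "(U - {u}) \<rightarrow>\<^sub>E verts G"
  let ?n = "real (card (verts G))"
  define A where "A \<psi> = {a \<in> verts G. \<psi>(u := a) \<in> coloured_homs G c U}" for \<psi>
  have finX: "finite ?X" using V U by (intro finite_PiE) auto
  have finA: "finite (A \<psi>)" for \<psi> using V by (simp add: A_def)
  have inj1: "inj_on (\<lambda>(\<psi>, a). \<psi>(u := a)) (Sigma ?X A)"
  proof (rule inj_on_inverseI[where g = "\<lambda>\<phi>. (restrict \<phi> (U - {u}), \<phi> u)"])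
    fix p assume "p \<in> Sigma ?X A"
    thus "(restrict ((\<lambda>(\<psi>, a). \<psi>(u := a)) p) (U - {u}), ((\<lambda>(\<psi>, a). \<psi>(u := a)) p) u) = p"
      by (auto simp: fun_eq_iff PiE_def extensional_def restrict_def)
  qed
  have im1: "(\<lambda>(\<psi>, a). \<psi>(u := a)) ` Sigma ?X A = coloured_homs G c U"
  proof (intro equalityI subsetI)
    fix \<phi> assume "\<phi> \<in> (\<lambda>(\<psi>, a). \<psi>(u := a)) ` Sigma ?X A"
    then obtain p where "p \<in> Sigma ?X A" "\<phi> = (\<lambda>(\<psi>, a). \<psi>(u := a)) p" unfolding image_iff by blast
    thus "\<phi> \<in> coloured_homs G c U" by (cases p) (simp add: A_def)
  next
    fix \<phi> assume \<phi>: "\<phi> \<in> coloured_homs G c U"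
    hence P: "\<phi> \<in> U \<rightarrow>\<^sub>E verts G" by (simp add: coloured_homs_def)
    have eq: "(restrict \<phi> (U - {u}))(u := \<phi> u) = \<phi>"
      using P U by (auto simp: fun_eq_iff PiE_def extensional_def restrict_def)
    have "restrict \<phi> (U - {u}) \<in> ?X" using P by auto
    moreover have "\<phi> u \<in> A (restrict \<phi> (U - {u}))"
      using \<phi> P U(2) unfolding A_def mem_Collect_eq eq by blast
    ultimately show "\<phi> \<in> (\<lambda>(\<psi>, a). \<psi>(u := a)) ` Sigma ?X A"
      by (intro image_eqI[of _ _ "(restrict \<phi> (U - {u}), \<phi> u)"])
        (simp_all only: eq split_conv mem_Sigma_iff simp_thms)
  qed
  have card1: "card (coloured_homs G c U) = (\<Sum>\<psi>\<in>?X. card (A \<psi>))"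
    using card_image[OF inj1] im1 finX finA by (simp add: card_SigmaI)
  let ?ext = "\<lambda>(\<psi>, a, b). \<psi>(u := a, w := b)"
  let ?Y = "Sigma ?X (\<lambda>\<psi>. A \<psi> \<times> A \<psi>)"
  have uw: "u \<noteq> w" using U by auto
  have inj2: "inj_on ?ext ?Y"
  proof (rule inj_on_inverseI[where g = "\<lambda>\<phi>. (restrict \<phi> (U - {u}), \<phi> u, \<phi> w)"])
    fix p assume "p \<in> ?Y"
    thus "(restrict (?ext p) (U - {u}), ?ext p u, ?ext p w) = p"
      using uw U by (auto simp: fun_eq_iff PiE_def extensional_def restrict_def)
  qed
  have im2: "?ext ` ?Y \<subseteq> coloured_homs G c (insert w U)"
  proof
    fix \<phi> assume "\<phi> \<in> ?ext ` ?Y"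
    then obtain y where "y \<in> ?Y" "\<phi> = ?ext y" unfolding image_iff by blast
    then obtain \<psi> a b where p: "\<phi> = \<psi>(u := a, w := b)" "\<psi> \<in> ?X" "a \<in> A \<psi>" "b \<in> A \<psi>"
      by (cases y) simp
    have h: "\<psi>(u := a) \<in> coloured_homs G c U" "\<psi>(u := b) \<in> coloured_homs G c U"
      and b: "a \<in> verts G" "b \<in> verts G"
      using p by (auto simp: A_def)
    have ha: "(if p = u then a else \<psi> p, if q = u then a else \<psi> q) \<in> edges G"
      if "p \<in> U" "q \<in> U" "c p \<noteq> c q" for p q
      using h(1) that by (auto simp: coloured_homs_def)
    have hb: "(if p = u then b else \<psi> p, if q = u then b else \<psi> q) \<in> edges G"
      if "p \<in> U" "q \<in> U" "c p \<noteq> c q" for p q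
      using h(2) that by (auto simp: coloured_homs_def)
    have "\<phi> \<in> insert w U \<rightarrow>\<^sub>E verts G"
      using p(1,2) b U by (auto simp: PiE_def extensional_def Pi_def)
    moreover have "(\<phi> p, \<phi> q) \<in> edges G"
      if pq: "p \<in> insert w U" "q \<in> insert w U" "c p \<noteq> c q" for p q
    proof -
      consider "p \<noteq> w" "q \<noteq> w" | "p = w" "q \<noteq> w" | "p \<noteq> w" "q = w" using pq by metis
      thus ?thesis
      proof cases
        case 1
        thus ?thesis using ha[of p q] that by (auto simp: p(1))
      next
        case 2
        hence "q \<noteq> u" using that U by auto
        thus ?thesis using hb[of u q] 2 that U uw by (auto simp: p(1))
      next
        case 3
        hence "p \<noteq> u" using that U by auto
        thus ?thesis using hb[of p u] 3 that U uw by (auto simp: p(1))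
      qed
    qed
    ultimately show "\<phi> \<in> coloured_homs G c (insert w U)" by (simp add: coloured_homs_def)
  qed
  have "(\<Sum>\<psi>\<in>?X. card (A \<psi>) ^ 2) = card ?Y"
    using finX finA by (simp add: card_SigmaI card_cartesian_product power2_eq_square)
  also have "\<dots> = card (?ext ` ?Y)" using card_image[OF inj2] by simp
  also have "\<dots> \<le> card (coloured_homs G c (insert w U))"
    by (intro card_mono im2 finite_coloured_homs V) (use U in simp)
  finally have card2: "(\<Sum>\<psi>\<in>?X. card (A \<psi>) ^ 2) \<le> card (coloured_homs G c (insert w U))" .
  have cardX: "real (card ?X) = ?n ^ (card U - 1)"
    using U by (subst card_funcsetE) (auto simp: card_Diff_singleton)
  have "real (card (coloured_homs G c U)) ^ 2 = (\<Sum>\<psi>\<in>?X. real (card (A \<psi>))) ^ 2"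
    by (simp add: card1)
  also have "\<dots> \<le> (\<Sum>\<psi>\<in>?X. real (card (A \<psi>)) ^ 2) * real (card ?X)"
    by (rule sum_squared_le_sum_of_squares)
  also have "\<dots> \<le> real (card (coloured_homs G c (insert w U))) * real (card ?X)"
    using of_nat_mono[OF card2, where 'a = real] by (intro mult_right_mono) auto
  finally have main: "real (card (coloured_homs G c U)) ^ 2
      \<le> real (card (coloured_homs G c (insert w U))) * ?n ^ (card U - 1)"
    by (simp add: cardX)
  obtain m where m: "card U = Suc m" using U by (metis card_Suc_Diff1)
  have cins: "card (insert w U) = Suc (Suc m)" using U m by simp
  show ?thesis
  proof (cases "?n = 0")
    case True
    thus ?thesis unfolding coloured_hom_density_def m cins by simp
  next
    case False
    hence n: "?n > 0" by simp
    have "(coloured_hom_density G c U)\<^sup>2 = real (card (coloured_homs G c U)) ^ 2 / ?n ^ (2 * Suc m)"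
      unfolding coloured_hom_density_def m
      by (simp only: power_divide power_mult[symmetric] mult.commute[of 2])
    also have "\<dots> \<le> real (card (coloured_homs G c (insert w U))) * ?n ^ m / ?n ^ (2 * Suc m)"
      using main m n by (intro divide_right_mono) auto
    also have "\<dots> = coloured_hom_density G c (insert w U)"
    proof -
      have "?n ^ (2 * Suc m) = ?n ^ m * ?n ^ Suc (Suc m)"
        by (simp only: power_add[symmetric]) (simp add: mult_2)
      thus ?thesis using n unfolding coloured_hom_density_def cins by (simp only:) (simp add: field_simps)
    qed
    finally show ?thesis .
  qed
qed

lemma coloured_hom_density_nonneg: "0 \<le> coloured_hom_density G c U"
  by (simp add: coloured_hom_density_def)

lemma coloured_hom_density_blow_up:
  assumes V: "finite (verts G)" and U: "finite U" and W: "finite W" "W \<inter> U = {}" "c ` W \<subseteq> c ` U"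
  shows "coloured_hom_density G c U ^ (2 ^ card W) \<le> coloured_hom_density G c (W \<union> U)"
  using W
proof (induction W rule: finite_induct)
  case empty
  show ?case by simp
next
  case (insert w W)
  from insert.prems obtain u where u: "u \<in> U" "c w = c u" by auto
  have "coloured_hom_density G c U ^ (2 ^ card (insert w W))
      = (coloured_hom_density G c U ^ (2 ^ card W))\<^sup>2"
    using insert.hyps by (simp add: power_mult[symmetric] mult.commute)
  also have "\<dots> \<le> (coloured_hom_density G c (W \<union> U))\<^sup>2"
    using insert by (intro power_mono zero_le_power coloured_hom_density_nonneg) auto
  also have "\<dots> \<le> coloured_hom_density G c (insert w (W \<union> U))"
    using insert.prems insert.hyps u U
    by (intro coloured_hom_density_clone[where u = u] V) auto
  finally show ?case by simp
qed

text \<open>The pattern is a \<open>k\<close>-clique in which, for each vertex of \<open>H\<close>, the clique vertex of its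
  colour has been cloned once more; the clones span a graph that contains \<open>H\<close>.  An injective
  homomorphism from this pattern would embed \<open>H\<close>, so in an \<open>H\<close>-free graph only the few
  non-injective maps can be homomorphisms.\<close>

lemma coloured_hom_density_le_if_free:
  fixes H :: "'h graph" and G :: "'a graph"
  assumes H: "simple_graph H" "proper_colouring H k c"
    and G: "simple_graph G" "card (verts G) > 0" "\<not> contains_subgraph G H"
  defines "w \<equiv> card (verts H)"
  shows "coloured_hom_density G id {..<k} ^ (2 ^ w) \<le> 1 - injective_fraction (w + k) (card (verts G))"
proof -
  define W :: "('h + nat) set" where "W = Inl ` verts H"
  define U :: "('h + nat) set" where "U = Inr ` {..<k}"
  define d where "d = case_sum c (id :: nat \<Rightarrow> nat)"
  let ?n = "card (verts G)"
  have fin: "finite W" "finite U" "finite (verts G)"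
    using H G by (auto simp: W_def U_def simple_graph_def)
  have disj: "W \<inter> U = {}" by (auto simp: W_def U_def)
  have card: "card W = w" "card U = k" "card (W \<union> U) = w + k"
    using fin disj by (auto simp: W_def U_def w_def card_image card_Un_disjoint)
  have dU: "d ` W \<subseteq> d ` U"
    using H(2) unfolding proper_colouring_def by (force simp: W_def U_def d_def image_iff)
  have not_inj: "\<not> inj_on \<phi> (W \<union> U)" if \<phi>: "\<phi> \<in> coloured_homs G d (W \<union> U)" for \<phi>
  proof
    assume inj: "inj_on \<phi> (W \<union> U)"
    have "inj_on (\<phi> \<circ> Inl) (verts H)"
      using inj by (auto simp: inj_on_def W_def)
    moreover have "(\<phi> \<circ> Inl) ` verts H \<subseteq> verts G"
      using \<phi> by (auto simp: coloured_homs_def W_def PiE_def Pi_def)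
    moreover have "((\<phi> \<circ> Inl) u, (\<phi> \<circ> Inl) v) \<in> edges G"
      if "u \<in> verts H" "v \<in> verts H" "(u, v) \<in> edges H" for u v
    proof -
      have "d (Inl u) \<noteq> d (Inl v)" using H(2) that by (auto simp: d_def proper_colouring_def)
      thus ?thesis using \<phi> that by (auto simp: coloured_homs_def W_def)
    qed
    ultimately show False using G(3) unfolding contains_subgraph_def by blast
  qed
  have "card {\<phi> \<in> W \<union> U \<rightarrow>\<^sub>E verts G. inj_on \<phi> (W \<union> U)} + card (coloured_homs G d (W \<union> U))
      = card ({\<phi> \<in> W \<union> U \<rightarrow>\<^sub>E verts G. inj_on \<phi> (W \<union> U)} \<union> coloured_homs G d (W \<union> U))"
    using not_inj fin
    by (intro card_Un_disjoint[symmetric] finite_coloured_homs)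
       (auto intro: finite_subset[OF _ finite_PiE[of "W \<union> U" "\<lambda>_. verts G"]])
  also have "\<dots> \<le> card (W \<union> U \<rightarrow>\<^sub>E verts G)"
    using fin by (intro card_mono finite_PiE) (auto simp: coloured_homs_def)
  also have "\<dots> = ?n ^ (w + k)" using fin card by (simp add: card_funcsetE)
  finally have "real (card {\<phi> \<in> W \<union> U \<rightarrow>\<^sub>E verts G. inj_on \<phi> (W \<union> U)})
      + real (card (coloured_homs G d (W \<union> U))) \<le> real ?n ^ (w + k)"
    unfolding of_nat_add[symmetric] of_nat_power[symmetric] by (rule of_nat_mono)
  hence "injective_fraction (w + k) ?n * real ?n ^ (w + k) + real (card (coloured_homs G d (W \<union> U)))
      \<le> real ?n ^ (w + k)"
    using card_injective_maps[of "W \<union> U" "verts G"] fin G(2) card by simp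
  hence "coloured_hom_density G d (W \<union> U) \<le> 1 - injective_fraction (w + k) ?n"
    using G(2) unfolding coloured_hom_density_def card by (simp add: field_simps)
  moreover have "coloured_hom_density G d U ^ (2 ^ w) \<le> coloured_hom_density G d (W \<union> U)"
    using coloured_hom_density_blow_up[OF fin(3,2,1) disj dU] card by simp
  moreover have "coloured_hom_density G id {..<k} \<le> coloured_hom_density G d U"
  proof -
    let ?e = "\<lambda>\<phi> :: nat \<Rightarrow> 'a. restrict (\<lambda>z. case z of Inl h \<Rightarrow> undefined | Inr i \<Rightarrow> \<phi> i) U"
    have "inj_on ?e (coloured_homs G id {..<k})"
    proof (rule inj_on_inverseI[where g = "\<lambda>\<psi>. restrict (\<psi> \<circ> Inr) {..<k}"])
      fix \<phi> assume "\<phi> \<in> coloured_homs G id {..<k}"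
      thus "restrict (?e \<phi> \<circ> Inr) {..<k} = \<phi>"
        by (auto simp: fun_eq_iff coloured_homs_def PiE_def extensional_def restrict_def U_def)
    qed
    moreover have "?e ` coloured_homs G id {..<k} \<subseteq> coloured_homs G d U"
      by (auto simp: coloured_homs_def U_def d_def)
    ultimately have "card (coloured_homs G id {..<k}) \<le> card (coloured_homs G d U)"
      using fin by (intro card_inj_on_le finite_coloured_homs)
    thus ?thesis unfolding coloured_hom_density_def card by (simp add: divide_right_mono)
  qed
  ultimately show ?thesis
    using power_mono[of "coloured_hom_density G id {..<k}" "coloured_hom_density G d U" "2 ^ w"]
      coloured_hom_density_nonneg[of G id "{..<k}"] by linarith
qed

text \<open>Every clique is the image of a homomorphism, and \<open>(n / k) ^ k \<le> n choose k\<close> converts the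
  normalization.\<close>

lemma clique_frac_le_coloured_hom_density:
  assumes G: "simple_graph G" and k: "k \<le> card (verts G)" "k > 0"
  shows "induced_frac k {complete_nat_graph k} G \<le> real k ^ k * coloured_hom_density G id {..<k}"
proof -
  let ?n = "card (verts G)"
  let ?Q = "{S. S \<subseteq> verts G \<and> card S = k \<and> iso_to_member (induced_subgraph G S) {complete_nat_graph k}}"
  have fin: "finite (verts G)" using G by (simp add: simple_graph_def)
  have "?Q \<subseteq> (\<lambda>\<phi>. \<phi> ` {..<k}) ` coloured_homs G id {..<k}"
  proof
    fix S assume "S \<in> ?Q"
    hence S: "S \<subseteq> verts G" and "graph_iso (induced_subgraph G S) (complete_nat_graph k)"
      by (simp_all add: iso_to_member_def)
    from graph_iso_sym[OF this(2)] obtain f where f: "bij_betw f {..<k} S"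
        "\<And>i j. i < k \<Longrightarrow> j < k \<Longrightarrow> i \<noteq> j \<Longrightarrow> (f i, f j) \<in> edges G"
      unfolding graph_iso_def by (auto simp: complete_nat_graph_def induced_subgraph_def)
    have "restrict f {..<k} \<in> coloured_homs G id {..<k}"
      using f S bij_betwE[OF f(1)] by (auto simp: coloured_homs_def)
    moreover have "S = restrict f {..<k} ` {..<k}"
      using f(1) by (simp add: bij_betw_def)
    ultimately show "S \<in> (\<lambda>\<phi>. \<phi> ` {..<k}) ` coloured_homs G id {..<k}" by blast
  qed
  hence "card ?Q \<le> card (coloured_homs G id {..<k})"
    using fin by (intro surj_card_le finite_coloured_homs) auto
  hence "real (induced_count k {complete_nat_graph k} G) \<le> coloured_hom_density G id {..<k} * real ?n ^ k"
    using k by (simp add: induced_count_def coloured_hom_density_def)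
  also have "\<dots> = real k ^ k * coloured_hom_density G id {..<k} * (real ?n / real k) ^ k"
    using k by (simp add: power_divide)
  also have "\<dots> \<le> real k ^ k * coloured_hom_density G id {..<k} * real (?n choose k)"
    using binomial_ge_n_over_k_pow_k[OF k(1), where 'a = real]
    by (intro mult_left_mono mult_nonneg_nonneg coloured_hom_density_nonneg) auto
  finally show ?thesis
    using k unfolding induced_frac_def by (simp add: pos_divide_le_eq)
qed

section \<open>Sampling a subset of bounded size\<close>

lemma card_supersets:
  assumes V: "finite V" "S \<subseteq> V" "card S = r" "r \<le> m"
  shows "card {M. S \<subseteq> M \<and> M \<subseteq> V \<and> card M = m} = (card V - r) choose (m - r)"
proof -
  have finS: "finite S" using V finite_subset by blast
  have "bij_betw (\<lambda>M. M - S) {M. S \<subseteq> M \<and> M \<subseteq> V \<and> card M = m} {M. M \<subseteq> V - S \<and> card M = m - r}"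
  proof (rule bij_betw_byWitness[where f' = "\<lambda>M. M \<union> S"])
    show "(\<lambda>M. M - S) ` {M. S \<subseteq> M \<and> M \<subseteq> V \<and> card M = m} \<subseteq> {M. M \<subseteq> V - S \<and> card M = m - r}"
      using finS V by (auto simp: card_Diff_subset)
    show "(\<lambda>M. M \<union> S) ` {M. M \<subseteq> V - S \<and> card M = m - r} \<subseteq> {M. S \<subseteq> M \<and> M \<subseteq> V \<and> card M = m}"
    proof clarify
      fix M assume M: "M \<subseteq> V - S" "card M = m - r"
      have "card (M \<union> S) = m"
        using M V finS by (subst card_Un_disjoint) (auto intro: finite_subset)
      thus "S \<subseteq> M \<union> S \<and> M \<union> S \<subseteq> V \<and> card (M \<union> S) = m" using M V by auto
    qed
  qed auto
  hence "card {M. S \<subseteq> M \<and> M \<subseteq> V \<and> card M = m} = card {M. M \<subseteq> V - S \<and> card M = m - r}"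
    by (rule bij_betw_same_card)
  also have "\<dots> = card (V - S) choose (m - r)" using V by (intro n_subsets) auto
  finally show ?thesis using V finS by (simp add: card_Diff_subset)
qed

text \<open>A uniformly random \<open>r\<close>-subset of a uniformly random \<open>m\<close>-subset is a uniformly random
  \<open>r\<close>-subset.  The lemma is used both for \<open>F\<close> and for the family that consists of one complete
  graph.\<close>

lemma sum_induced_frac_subsets:
  assumes G: "finite (verts G)" and rm: "r \<le> m" "m \<le> card (verts G)"
  shows "(\<Sum>M\<in>{M. M \<subseteq> verts G \<and> card M = m}. induced_frac r F (induced_subgraph G M))
     = real (card (verts G) choose m) * induced_frac r F G"
proof -
  let ?n = "card (verts G)"
  let ?Ms = "{M. M \<subseteq> verts G \<and> card M = m}"
  let ?T = "{S. S \<subseteq> verts G \<and> card S = r \<and> iso_to_member (induced_subgraph G S) F}"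
  have cnt: "induced_count r F (induced_subgraph G M) = card {S\<in>?T. S \<subseteq> M}" if "M \<subseteq> verts G" for M
  proof -
    have "induced_subgraph (induced_subgraph G M) S = induced_subgraph G S" if "S \<subseteq> M" for S
      using that by (auto simp: induced_subgraph_def)
    moreover have "verts (induced_subgraph G M) = M" by (simp add: induced_subgraph_def)
    ultimately show ?thesis
      unfolding induced_count_def using that
      by (intro arg_cong[where f = card] Collect_cong) auto
  qed
  have fin: "finite ?Ms" "finite ?T" using G by auto
  have "\<forall>S\<in>?T. card {M\<in>?Ms. S \<subseteq> M} = (?n - r) choose (m - r)"
  proof
    fix S assume S: "S \<in> ?T"
    have "{M\<in>?Ms. S \<subseteq> M} = {M. S \<subseteq> M \<and> M \<subseteq> verts G \<and> card M = m}" by auto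
    thus "card {M\<in>?Ms. S \<subseteq> M} = (?n - r) choose (m - r)"
      using card_supersets[OF G _ _ rm(1), of S] S by simp
  qed
  from sum_multicount[OF fin this]
  have count: "(\<Sum>M\<in>?Ms. induced_count r F (induced_subgraph G M))
      = ((?n - r) choose (m - r)) * induced_count r F G"
    using cnt by (simp add: induced_count_def)
  have choose: "real (?n choose m) * real (m choose r) = real (?n choose r) * real ((?n - r) choose (m - r))"
    using choose_mult[OF rm] by (metis of_nat_mult)
  have pos: "real (m choose r) > 0" "real (?n choose r) > 0" using rm by auto
  have "(\<Sum>M\<in>?Ms. induced_frac r F (induced_subgraph G M))
      = (\<Sum>M\<in>?Ms. real (induced_count r F (induced_subgraph G M)) / real (m choose r))"
    by (intro sum.cong) (auto simp: induced_frac_def, auto simp: induced_subgraph_def)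
  also have "\<dots> = real (((?n - r) choose (m - r)) * induced_count r F G) / real (m choose r)"
    unfolding count[symmetric] by (simp add: sum_divide_distrib)
  also have "\<dots> = real (?n choose m) * induced_frac r F G"
    using choose pos unfolding induced_frac_def by (simp add: field_simps)
  finally show ?thesis .
qed

lemma clique_count_pos:
  assumes G: "simple_graph G" and K: "contains_subgraph G (complete_nat_graph k)"
  shows "induced_count k {complete_nat_graph k} G > 0"
proof -
  let ?Q = "{S. S \<subseteq> verts G \<and> card S = k \<and> iso_to_member (induced_subgraph G S) {complete_nat_graph k}}"
  obtain f where f: "inj_on f {..<k}" "f ` {..<k} \<subseteq> verts G"
      "\<And>i j. i < k \<Longrightarrow> j < k \<Longrightarrow> i \<noteq> j \<Longrightarrow> (f i, f j) \<in> edges G"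
    using K unfolding contains_subgraph_def complete_nat_graph_def by auto
  have loop: "(v, v) \<notin> edges G" for v using G by (auto simp: simple_graph_def irrefl_def)
  have "graph_iso (complete_nat_graph k) (induced_subgraph G (f ` {..<k}))"
    unfolding graph_iso_def
    using f loop by (intro exI[of _ f])
      (auto simp: complete_nat_graph_def induced_subgraph_def bij_betw_def)
  hence "iso_to_member (induced_subgraph G (f ` {..<k})) {complete_nat_graph k}"
    unfolding iso_to_member_def using graph_iso_sym by blast
  hence "f ` {..<k} \<in> ?Q" using f by (simp add: card_image)
  moreover have "finite ?Q" using G by (simp add: simple_graph_def)
  ultimately show ?thesis unfolding induced_count_def using card_gt_0_iff by blast
qed

text \<open>Average over all \<open>m\<close>-subsets.  Those without a \<open>k\<close>-clique have density at most the
  \<open>K\<^sub>k\<close>-free maximum; the others have density at most 1, which the number of their cliques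
  dominates, and the expected number of cliques is the second summand.\<close>

lemma induced_frac_le_sampling:
  fixes G :: "nat graph"
  assumes G: "simple_graph G" and m: "r \<le> m" "k \<le> m" "m \<le> card (verts G)" and k: "k \<ge> 2"
  shows "induced_frac r F G \<le> max_induced_frac (complete_nat_graph k) r F m
    + real (m choose k) * induced_frac k {complete_nat_graph k} G"
proof -
  let ?n = "card (verts G)"
  let ?K = "complete_nat_graph k"
  let ?mu = "max_induced_frac ?K r F m"
  let ?Ms = "{M. M \<subseteq> verts G \<and> card M = m}"
  have fin: "finite (verts G)" using G by (simp add: simple_graph_def)
  have each: "induced_frac r F (induced_subgraph G M)
      \<le> ?mu + real (m choose k) * induced_frac k {?K} (induced_subgraph G M)" if M: "M \<in> ?Ms" for M
  proof -
    let ?G = "induced_subgraph G M"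
    have s: "simple_graph ?G" using M by (intro simple_graph_induced G) auto
    have V: "verts ?G = M" and finM: "finite M"
      using M fin by (auto simp: induced_subgraph_def finite_subset)
    show ?thesis
    proof (cases "contains_subgraph ?G ?K")
      case False
      have "induced_frac r F ?G \<le> ?mu"
        using max_induced_frac_upper[OF s False, of r F] V M by simp
      thus ?thesis using induced_frac_nonneg[of k "{?K}" ?G]
        by (simp add: add_increasing2)
    next
      case True
      have "real (m choose k) * induced_frac k {?K} ?G = real (induced_count k {?K} ?G)"
        using V M m unfolding induced_frac_def by simp
      hence "1 \<le> real (m choose k) * induced_frac k {?K} ?G"
        using clique_count_pos[OF s True] by simp
      moreover have "0 \<le> ?mu"
        by (intro max_induced_frac_nonneg simple_complete_nat_graph
            edges_complete_nat_graph_nonempty k)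
      moreover have "induced_frac r F ?G \<le> 1" using finM V by (intro induced_frac_le_1) simp
      ultimately show ?thesis by linarith
    qed
  qed
  have "real (?n choose m) * induced_frac r F G
      = (\<Sum>M\<in>?Ms. induced_frac r F (induced_subgraph G M))"
    using sum_induced_frac_subsets[OF fin m(1,3)] by simp
  also have "\<dots> \<le> (\<Sum>M\<in>?Ms. ?mu + real (m choose k) * induced_frac k {?K} (induced_subgraph G M))"
    by (intro sum_mono each)
  also have "\<dots> = real (?n choose m) * ?mu + real (m choose k) *
      (\<Sum>M\<in>?Ms. induced_frac k {?K} (induced_subgraph G M))"
    using n_subsets[OF fin, of m] by (simp add: sum.distrib sum_distrib_left)
  also have "\<dots> = real (?n choose m) * (?mu + real (m choose k) * induced_frac k {?K} G)"
    unfolding sum_induced_frac_subsets[OF fin m(2,3)] by (simp add: algebra_simps)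
  finally show ?thesis using m(3) by simp
qed

text \<open>Let first the order of the \<open>H\<close>-free graphs tend to infinity, so that the clique term of the
  sampling bound vanishes, and then the size \<open>m\<close> of the sample.\<close>

lemma inducibility_le_complete:
  fixes H :: "'h graph"
  assumes H: "simple_graph H" "edges H \<noteq> {}" "proper_colouring H k c" and k: "k \<ge> 2"
  shows "inducibility H r F \<le> inducibility (complete_nat_graph k) r F"
proof -
  let ?K = "complete_nat_graph k"
  let ?w = "card (verts H)"
  have "\<forall>n. \<exists>G :: nat graph. simple_graph G \<and> card (verts G) = n \<and> \<not> contains_subgraph G H \<and>
      max_induced_frac H r F n = induced_frac r F G"
    using max_induced_frac_attained[OF H(1,2), of _ r F] by metis
  then obtain G :: "nat \<Rightarrow> nat graph" where G: "\<And>n. simple_graph (G n)" "\<And>n. card (verts (G n)) = n"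
      "\<And>n. \<not> contains_subgraph (G n) H" "\<And>n. max_induced_frac H r F n = induced_frac r F (G n)"
    by metis
  let ?q = "\<lambda>n. induced_frac k {?K} (G n)"
  let ?h = "\<lambda>n. coloured_hom_density (G n) id {..<k}"
  \<comment> \<open>The exponent does not depend on \<open>n\<close>, so a root turns this into convergence of the density
    itself.\<close>
  have "(\<lambda>n. ?h n ^ (2 ^ ?w)) \<longlonglongrightarrow> 0"
  proof (rule tendsto_sandwich)
    show "\<forall>\<^sub>F n in sequentially. 0 \<le> ?h n ^ (2 ^ ?w)"
      by (simp add: coloured_hom_density_nonneg)
    show "\<forall>\<^sub>F n in sequentially. ?h n ^ (2 ^ ?w) \<le> 1 - injective_fraction (?w + k) n"
      using eventually_gt_at_top[of 0]
    proof eventually_elim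
      case (elim n)
      thus ?case using coloured_hom_density_le_if_free[OF H(1,3) G(1)[of n] _ G(3)[of n]] G(2) by simp
    qed
    show "(\<lambda>n. 1 - injective_fraction (?w + k) n) \<longlonglongrightarrow> 0"
      using tendsto_diff[OF tendsto_const[of 1] tendsto_injective_fraction[of "?w + k"]] by simp
  qed simp
  hence "(\<lambda>n. root (2 ^ ?w) (?h n ^ (2 ^ ?w))) \<longlonglongrightarrow> root (2 ^ ?w) 0" by (rule tendsto_real_root)
  hence h: "?h \<longlonglongrightarrow> 0" by (simp add: real_root_power_cancel coloured_hom_density_nonneg)
  have q: "?q \<longlonglongrightarrow> 0"
  proof (rule tendsto_sandwich[where f = "\<lambda>_. 0" and h = "\<lambda>n. real k ^ k * ?h n"])
    show "\<forall>\<^sub>F n in sequentially. ?q n \<le> real k ^ k * ?h n"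
      using eventually_ge_at_top[of k]
    proof eventually_elim
      case (elim n)
      thus ?case using clique_frac_le_coloured_hom_density[OF G(1)[of n], of k] G(2) k by simp
    qed
    show "(\<lambda>n. real k ^ k * ?h n) \<longlonglongrightarrow> 0"
      using tendsto_mult_right_zero[OF h] by simp
  qed (simp_all add: induced_frac_nonneg)
  have conv: "max_induced_frac H r F \<longlonglongrightarrow> inducibility H r F"
    by (rule max_induced_frac_tendsto_inducibility[OF H(1,2)])
  have convK: "max_induced_frac ?K r F \<longlonglongrightarrow> inducibility ?K r F"
    by (rule max_induced_frac_tendsto_inducibility[OF simple_complete_nat_graph
          edges_complete_nat_graph_nonempty[OF k]])
  have m: "inducibility H r F \<le> max_induced_frac ?K r F m" if "r + k \<le> m" for m
  proof (rule tendsto_le[OF _ _ conv])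
    show "(\<lambda>n. max_induced_frac ?K r F m + real (m choose k) * ?q n) \<longlonglongrightarrow> max_induced_frac ?K r F m"
      using tendsto_add[OF tendsto_const tendsto_mult_right_zero[OF q]] by simp
    show "\<forall>\<^sub>F n in sequentially. max_induced_frac H r F n \<le> max_induced_frac ?K r F m + real (m choose k) * ?q n"
      using eventually_ge_at_top[of m]
    proof eventually_elim
      case (elim n)
      thus ?case
        using induced_frac_le_sampling[OF G(1)[of n], of r m k F] G(2,4) that k by simp
    qed
  qed simp
  show ?thesis
    by (rule tendsto_lowerbound[OF convK _ sequentially_bot])
       (use m in \<open>auto intro: eventually_sequentiallyI\<close>)
qed

section \<open>Limit densities of complete multipartite graphs\<close>

definition colour_graph :: "nat \<Rightarrow> (nat \<Rightarrow> nat) \<Rightarrow> nat graph" where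
  "colour_graph r \<gamma> = ({..<r}, {(i, j). i < r \<and> j < r \<and> \<gamma> i \<noteq> \<gamma> j})"

text \<open>The probability that a sample of \<open>r\<close> independent points, each of which falls into part \<open>i\<close>
  with probability \<open>x i\<close>, induces a member of \<open>F\<close>; the sum runs over the possible assignments of
  points to parts.\<close>

definition multipartite_density :: "nat \<Rightarrow> nat graph set \<Rightarrow> nat set \<Rightarrow> (nat \<Rightarrow> real) \<Rightarrow> real" where
  "multipartite_density r F I x =
     (\<Sum>\<gamma>\<in>{..<r} \<rightarrow>\<^sub>E I. of_bool (iso_to_member (colour_graph r \<gamma>) F) * (\<Prod>i<r. x (\<gamma> i)))"

lemma colour_graph_cong:
  assumes "\<And>i j. i < r \<Longrightarrow> j < r \<Longrightarrow> \<gamma> i = \<gamma> j \<longleftrightarrow> \<delta> i = \<delta> j"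
  shows "colour_graph r \<gamma> = colour_graph r \<delta>"
  using assms by (auto simp: colour_graph_def)

lemma card_maps_with_pattern:
  assumes V: "finite V" and c: "\<And>v. v \<in> V \<Longrightarrow> c v < l"
  shows "real (card {\<phi> \<in> {..<r} \<rightarrow>\<^sub>E V. iso_to_member (colour_graph r (c \<circ> \<phi>)) F})
    = (\<Sum>\<gamma>\<in>{..<r} \<rightarrow>\<^sub>E {..<l}. of_bool (iso_to_member (colour_graph r \<gamma>) F) *
         (\<Prod>i<r. real (card {v\<in>V. c v = \<gamma> i})))"
proof -
  let ?\<Gamma> = "{..<r} \<rightarrow>\<^sub>E {..<l}"
  let ?B = "\<lambda>\<gamma>. PiE {..<r} (\<lambda>i. {v\<in>V. c v = \<gamma> i})"
  let ?P = "\<lambda>\<gamma>. iso_to_member (colour_graph r \<gamma>) F"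
  have fin\<Gamma>: "finite ?\<Gamma>" by (intro finite_PiE) auto
  have pat: "colour_graph r (c \<circ> \<phi>) = colour_graph r \<gamma>" if "\<phi> \<in> ?B \<gamma>" for \<phi> \<gamma>
    using that by (intro colour_graph_cong) (auto simp: PiE_iff)
  have eq: "{\<phi> \<in> {..<r} \<rightarrow>\<^sub>E V. ?P (c \<circ> \<phi>)} = (\<Union>\<gamma>\<in>{\<gamma>\<in>?\<Gamma>. ?P \<gamma>}. ?B \<gamma>)"
  proof (intro equalityI subsetI)
    fix \<phi> assume "\<phi> \<in> {\<phi> \<in> {..<r} \<rightarrow>\<^sub>E V. ?P (c \<circ> \<phi>)}"
    hence \<phi>: "\<phi> \<in> {..<r} \<rightarrow>\<^sub>E V" "?P (c \<circ> \<phi>)" by auto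
    let ?\<gamma> = "restrict (c \<circ> \<phi>) {..<r}"
    have mem: "\<phi> \<in> ?B ?\<gamma>" using \<phi>(1) by (simp add: PiE_iff)
    have "?P ?\<gamma>" using \<phi>(2) unfolding pat[OF mem] .
    moreover have "?\<gamma> \<in> ?\<Gamma>" using \<phi>(1) c by (simp add: PiE_iff)
    ultimately show "\<phi> \<in> (\<Union>\<gamma>\<in>{\<gamma>\<in>?\<Gamma>. ?P \<gamma>}. ?B \<gamma>)" using mem by blast
  next
    fix \<phi> assume "\<phi> \<in> (\<Union>\<gamma>\<in>{\<gamma>\<in>?\<Gamma>. ?P \<gamma>}. ?B \<gamma>)"
    then obtain \<gamma> where \<gamma>: "?P \<gamma>" "\<phi> \<in> ?B \<gamma>" by blast
    have "?P (c \<circ> \<phi>)" using \<gamma>(1) unfolding pat[OF \<gamma>(2)] .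
    thus "\<phi> \<in> {\<phi> \<in> {..<r} \<rightarrow>\<^sub>E V. ?P (c \<circ> \<phi>)}" using \<gamma>(2) by (simp add: PiE_iff)
  qed
  have disj: "?B \<gamma> \<inter> ?B \<delta> = {}" if gd: "\<gamma> \<in> ?\<Gamma>" "\<delta> \<in> ?\<Gamma>" "\<gamma> \<noteq> \<delta>" for \<gamma> \<delta>
  proof -
    obtain i where "i < r" "\<gamma> i \<noteq> \<delta> i"
      using gd(3) PiE_ext[OF gd(1,2)] by auto
    thus ?thesis by (fastforce simp: PiE_iff)
  qed
  have "card {\<phi> \<in> {..<r} \<rightarrow>\<^sub>E V. ?P (c \<circ> \<phi>)} = (\<Sum>\<gamma>\<in>{\<gamma>\<in>?\<Gamma>. ?P \<gamma>}. card (?B \<gamma>))"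
    unfolding eq
  proof (rule card_UN_disjoint)
    show "finite {\<gamma>\<in>?\<Gamma>. ?P \<gamma>}" using fin\<Gamma> by simp
    show "\<forall>\<gamma>\<in>{\<gamma>\<in>?\<Gamma>. ?P \<gamma>}. finite (?B \<gamma>)"
      using V by (intro ballI finite_PiE) auto
    show "\<forall>\<gamma>\<in>{\<gamma>\<in>?\<Gamma>. ?P \<gamma>}. \<forall>\<delta>\<in>{\<gamma>\<in>?\<Gamma>. ?P \<gamma>}. \<gamma> \<noteq> \<delta> \<longrightarrow> ?B \<gamma> \<inter> ?B \<delta> = {}"
      by (intro ballI impI disj) (simp_all only: mem_Collect_eq not_False_eq_True)
  qed
  also have "real \<dots> = (\<Sum>\<gamma>\<in>{\<gamma>\<in>?\<Gamma>. ?P \<gamma>}. \<Prod>i<r. real (card {v\<in>V. c v = \<gamma> i}))"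
    by (simp add: card_PiE)
  also have "\<dots> = (\<Sum>\<gamma>\<in>?\<Gamma>. of_bool (?P \<gamma>) * (\<Prod>i<r. real (card {v\<in>V. c v = \<gamma> i})))"
    using fin\<Gamma> by (intro sum.mono_neutral_cong_left) auto
  finally show ?thesis .
qed

text \<open>Each counted vertex set is the image of exactly \<open>r!\<close> injective maps.\<close>

lemma card_injective_maps_with_pattern:
  assumes G: "finite (verts G)" and c: "partition_colouring G l c"
  shows "card {\<phi> \<in> {..<r} \<rightarrow>\<^sub>E verts G. inj_on \<phi> {..<r} \<and> iso_to_member (colour_graph r (c \<circ> \<phi>)) F}
    = fact r * induced_count r F G"
proof -
  let ?T = "{S. S \<subseteq> verts G \<and> card S = r \<and> iso_to_member (induced_subgraph G S) F}"
  let ?B = "\<lambda>S. {\<phi> \<in> {..<r} \<rightarrow>\<^sub>E S. inj_on \<phi> {..<r}}"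
  have im: "\<phi> ` {..<r} = S" if "S \<in> ?T" "\<phi> \<in> ?B S" for S \<phi>
    using that G by (intro card_subset_eq) (auto simp: card_image finite_subset)
  have iso: "iso_to_member (colour_graph r (c \<circ> \<phi>)) F \<longleftrightarrow>
      iso_to_member (induced_subgraph G (\<phi> ` {..<r})) F"
    if "\<phi> \<in> {..<r} \<rightarrow>\<^sub>E verts G" "inj_on \<phi> {..<r}" for \<phi>
  proof (rule iso_to_member_cong)
    have "(c (\<phi> i) \<noteq> c (\<phi> j)) = ((\<phi> i, \<phi> j) \<in> edges G)" if "i < r" "j < r" for i j
      using c that \<open>\<phi> \<in> {..<r} \<rightarrow>\<^sub>E verts G\<close> by (auto simp: partition_colouring_def PiE_iff)
    thus "graph_iso (colour_graph r (c \<circ> \<phi>)) (induced_subgraph G (\<phi> ` {..<r}))"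
      unfolding graph_iso_def using that(2)
      by (intro exI[of _ \<phi>]) (simp add: colour_graph_def induced_subgraph_def bij_betw_def)
  qed
  have eq: "{\<phi> \<in> {..<r} \<rightarrow>\<^sub>E verts G. inj_on \<phi> {..<r} \<and> iso_to_member (colour_graph r (c \<circ> \<phi>)) F}
      = (\<Union>S\<in>?T. ?B S)"
  proof (intro equalityI subsetI)
    fix \<phi> assume "\<phi> \<in> {\<phi> \<in> {..<r} \<rightarrow>\<^sub>E verts G. inj_on \<phi> {..<r} \<and> iso_to_member (colour_graph r (c \<circ> \<phi>)) F}"
    hence \<phi>: "\<phi> \<in> {..<r} \<rightarrow>\<^sub>E verts G" "inj_on \<phi> {..<r}" "iso_to_member (colour_graph r (c \<circ> \<phi>)) F"
      by auto
    have "\<phi> ` {..<r} \<in> ?T" using \<phi> iso[OF \<phi>(1,2)] by (auto simp: card_image)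
    moreover have "\<phi> \<in> ?B (\<phi> ` {..<r})" using \<phi> by (simp add: PiE_iff)
    ultimately show "\<phi> \<in> (\<Union>S\<in>?T. ?B S)" by blast
  next
    fix \<phi> assume "\<phi> \<in> (\<Union>S\<in>?T. ?B S)"
    then obtain S where S: "S \<in> ?T" "\<phi> \<in> ?B S" by blast
    hence \<phi>: "\<phi> \<in> {..<r} \<rightarrow>\<^sub>E verts G" "inj_on \<phi> {..<r}" by (auto simp: PiE_iff)
    show "\<phi> \<in> {\<phi> \<in> {..<r} \<rightarrow>\<^sub>E verts G. inj_on \<phi> {..<r} \<and> iso_to_member (colour_graph r (c \<circ> \<phi>)) F}"
      using iso[OF \<phi>] im[OF S] S(1) \<phi> by simp
  qed
  have "card (\<Union>S\<in>?T. ?B S) = (\<Sum>S\<in>?T. card (?B S))"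
  proof (rule card_UN_disjoint)
    show "finite ?T" using G by simp
    show "\<forall>S\<in>?T. finite (?B S)"
    proof
      fix S assume "S \<in> ?T"
      hence "finite S" using G finite_subset by blast
      hence "finite ({..<r} \<rightarrow>\<^sub>E S)" by (intro finite_PiE) auto
      thus "finite (?B S)" by simp
    qed
    show "\<forall>S\<in>?T. \<forall>S'\<in>?T. S \<noteq> S' \<longrightarrow> ?B S \<inter> ?B S' = {}"
    proof (intro ballI impI)
      fix S S' assume A: "S \<in> ?T" "S' \<in> ?T" "S \<noteq> S'"
      show "?B S \<inter> ?B S' = {}"
        unfolding disjoint_iff using im[OF A(1)] im[OF A(2)] A(3) by metis
    qed
  qed
  also have "\<dots> = (\<Sum>S\<in>?T. fact r)"
  proof (rule sum.cong)
    fix S assume S: "S \<in> ?T"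
    hence "finite S" using G finite_subset by blast
    thus "card (?B S) = fact r"
      using S card_inj_on_subset_funcset[of "{..<r}" S "{..<r}"] by (simp add: fact_prod_rev)
  qed simp
  finally show ?thesis unfolding eq by (simp add: induced_count_def mult.commute)
qed

text \<open>The polynomial counts all maps from \<open>{..<r}\<close> to the vertices with the right pattern, the
  induced fraction only the injective ones; they differ by at most the number of non-injective
  maps.\<close>

lemma induced_frac_multipartite_approx:
  assumes G: "finite (verts G)" "card (verts G) > 0" and r: "r \<le> card (verts G)"
    and c: "partition_colouring G l c"
  defines "n \<equiv> card (verts G)"
  shows "\<bar>induced_frac r F G -
      multipartite_density r F {..<l} (\<lambda>i. real (card {v \<in> verts G. c v = i}) / real n)\<bar>
    \<le> 1 - injective_fraction r n"
proof -
  let ?D = "multipartite_density r F {..<l} (\<lambda>i. real (card {v \<in> verts G. c v = i}) / real n)"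
  let ?p = "induced_frac r F G" and ?\<rho> = "injective_fraction r n"
  let ?All = "{..<r} \<rightarrow>\<^sub>E verts G"
  let ?\<Phi> = "{\<phi> \<in> ?All. iso_to_member (colour_graph r (c \<circ> \<phi>)) F}"
  let ?I = "{\<phi> \<in> ?All. inj_on \<phi> {..<r} \<and> iso_to_member (colour_graph r (c \<circ> \<phi>)) F}"
  let ?J = "{\<phi> \<in> ?All. inj_on \<phi> {..<r}}"
  have fin: "finite ?All" using G by (intro finite_PiE) auto
  have n: "real n ^ r > 0" using G by (simp add: n_def)
  have \<Phi>: "real (card ?\<Phi>) = real n ^ r * ?D"
    unfolding multipartite_density_def
    using card_maps_with_pattern[OF G(1), of c l r F] c n
    by (simp add: partition_colouring_def sum_distrib_left prod_dividef mult.left_commute)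
  have "real (n choose r) > 0" using r by (simp add: n_def)
  hence "real (card ?I) = (fact r * real (n choose r)) * ?p"
    using card_injective_maps_with_pattern[OF G(1) c, of r F]
    by (simp add: induced_frac_def n_def[symmetric])
  hence I: "real (card ?I) = real n ^ r * (?\<rho> * ?p)"
    using fact_mult_choose[of n r] G(2) by (simp add: n_def mult_ac)
  have J: "real (card ?J) = real n ^ r * ?\<rho>"
    using card_injective_maps[of "{..<r}" "verts G"] G by (simp add: n_def mult.commute)
  have All: "real (card ?All) = real n ^ r" by (simp add: card_funcsetE n_def)
  have "card ?I \<le> card ?\<Phi>" using fin by (intro card_mono) auto
  hence "real n ^ r * (?\<rho> * ?p) \<le> real n ^ r * ?D" unfolding I[symmetric] \<Phi>[symmetric] by simp
  hence lower: "?\<rho> * ?p \<le> ?D" using n by (simp only: mult_le_cancel_left_pos)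
  have "card ?\<Phi> + card ?J = card (?\<Phi> \<union> ?J) + card (?\<Phi> \<inter> ?J)"
    using fin by (intro card_Un_Int) auto
  moreover have "?\<Phi> \<inter> ?J = ?I" by blast
  moreover have "card (?\<Phi> \<union> ?J) \<le> card ?All" using fin by (intro card_mono) auto
  ultimately have "card ?\<Phi> + card ?J \<le> card ?All + card ?I" by (simp only: add_le_mono1)
  hence "real (card ?\<Phi>) + real (card ?J) \<le> real (card ?All) + real (card ?I)"
    unfolding of_nat_add[symmetric] by (rule of_nat_mono)
  hence "real n ^ r * (?D + ?\<rho>) \<le> real n ^ r * (1 + ?\<rho> * ?p)"
    unfolding \<Phi> J All I by (simp add: algebra_simps)
  hence upper: "?D + ?\<rho> \<le> 1 + ?\<rho> * ?p" using n by (simp only: mult_le_cancel_left_pos)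
  have p: "0 \<le> ?p" "?p \<le> 1" using induced_frac_nonneg[of r F G] induced_frac_le_1[OF G(1)] by auto
  have "card ?J \<le> card ?All" using fin by (intro card_mono) auto
  hence "real (card ?J) \<le> real (card ?All)" by simp
  hence "real n ^ r * ?\<rho> \<le> real n ^ r * 1" unfolding J All by simp
  hence \<rho>: "?\<rho> \<le> 1" using n by (simp only: mult_le_cancel_left_pos)
  have "(1 - ?\<rho>) * ?p \<le> 1 - ?\<rho>" using p \<rho> by (simp add: mult_left_le)
  hence "?p - ?\<rho> * ?p \<le> 1 - ?\<rho>" by (simp add: algebra_simps)
  moreover have "?\<rho> * ?p \<le> ?p" using mult_right_mono[OF \<rho> p(1)] by simp
  ultimately show ?thesis using lower upper by linarith
qed

lemma convergent_subsequence_finitely_many: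
  fixes y :: "nat \<Rightarrow> nat \<Rightarrow> real"
  assumes "\<And>n i. y n i \<in> {0..1}"
  shows "\<exists>s x. strict_mono s \<and> (\<forall>i<l. (\<lambda>n. y (s n) i) \<longlonglongrightarrow> x i)"
proof (induction l)
  case 0
  show ?case by (intro exI[of _ id]) (simp add: strict_mono_def)
next
  case (Suc l)
  then obtain s :: "nat \<Rightarrow> nat" and x where s: "strict_mono s" "\<And>i. i < l \<Longrightarrow> (\<lambda>n. y (s n) i) \<longlonglongrightarrow> x i"
    by blast
  have "seq_compact {0..1::real}" by (intro compact_imp_seq_compact compact_Icc)
  moreover have "\<forall>n. y (s n) l \<in> {0..1}" using assms by blast
  ultimately obtain a and t :: "nat \<Rightarrow> nat" where t: "strict_mono t" "((\<lambda>n. y (s n) l) \<circ> t) \<longlonglongrightarrow> a"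
    unfolding seq_compact_def by metis
  show ?case
  proof (intro exI[of _ "s \<circ> t"] exI[of _ "x(l := a)"] conjI allI impI)
    show "strict_mono (s \<circ> t)" using s t by (simp add: strict_mono_o)
    fix i assume "i < Suc l"
    thus "(\<lambda>n. y ((s \<circ> t) n) i) \<longlonglongrightarrow> (x(l := a)) i"
      using t(2) LIMSEQ_subseq_LIMSEQ[OF s(2) t(1), of i] by (auto simp: less_Suc_eq o_def)
  qed
qed

lemma multipartite_density_relabel:
  assumes e: "inj_on e J"
  shows "multipartite_density r F J (x \<circ> e) = multipartite_density r F (e ` J) x"
  unfolding multipartite_density_def
proof (rule sum.reindex_bij_witness[where
      i = "\<lambda>\<gamma>. restrict (the_inv_into J e \<circ> \<gamma>) {..<r}" and j = "\<lambda>\<gamma>. restrict (e \<circ> \<gamma>) {..<r}"])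
  fix \<gamma> assume \<gamma>: "\<gamma> \<in> {..<r} \<rightarrow>\<^sub>E J"
  hence J: "\<gamma> i \<in> J" if "i < r" for i using that by (auto simp: PiE_iff)
  show "restrict (the_inv_into J e \<circ> restrict (e \<circ> \<gamma>) {..<r}) {..<r} = \<gamma>"
    using \<gamma> J by (intro ext) (auto simp: PiE_iff extensional_def restrict_def the_inv_into_f_f[OF e])
  show "restrict (e \<circ> \<gamma>) {..<r} \<in> {..<r} \<rightarrow>\<^sub>E e ` J" using J by (simp add: PiE_iff)
  have "colour_graph r (restrict (e \<circ> \<gamma>) {..<r}) = colour_graph r \<gamma>"
    using J e by (intro colour_graph_cong) (simp add: inj_on_eq_iff)
  thus "of_bool (iso_to_member (colour_graph r (restrict (e \<circ> \<gamma>) {..<r})) F) *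
      (\<Prod>i<r. x (restrict (e \<circ> \<gamma>) {..<r} i)) =
    of_bool (iso_to_member (colour_graph r \<gamma>) F) * (\<Prod>i<r. (x \<circ> e) (\<gamma> i))"
    by simp
next
  fix \<gamma> assume \<gamma>: "\<gamma> \<in> {..<r} \<rightarrow>\<^sub>E e ` J"
  hence J: "\<gamma> i \<in> e ` J" if "i < r" for i using that by (auto simp: PiE_iff)
  show "restrict (e \<circ> restrict (the_inv_into J e \<circ> \<gamma>) {..<r}) {..<r} = \<gamma>"
    using \<gamma> J by (intro ext) (auto simp: PiE_iff extensional_def restrict_def f_the_inv_into_f[OF e])
  show "restrict (the_inv_into J e \<circ> \<gamma>) {..<r} \<in> {..<r} \<rightarrow>\<^sub>E J"
    using J the_inv_into_into[OF e _ subset_refl] by (simp add: PiE_iff)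
qed

lemma multipartite_density_drop_empty_parts:
  assumes I: "finite I" "J \<subseteq> I" and zero: "\<And>i. i \<in> I - J \<Longrightarrow> x i = 0"
  shows "multipartite_density r F J x = multipartite_density r F I x"
  unfolding multipartite_density_def
proof (rule sum.mono_neutral_left)
  show "finite ({..<r} \<rightarrow>\<^sub>E I)" using I by (intro finite_PiE) auto
  show "{..<r} \<rightarrow>\<^sub>E J \<subseteq> {..<r} \<rightarrow>\<^sub>E I" using I by (intro PiE_mono) auto
  show "\<forall>\<gamma>\<in>({..<r} \<rightarrow>\<^sub>E I) - ({..<r} \<rightarrow>\<^sub>E J).
      of_bool (iso_to_member (colour_graph r \<gamma>) F) * (\<Prod>i<r. x (\<gamma> i)) = 0"
  proof
    fix \<gamma> assume \<gamma>: "\<gamma> \<in> ({..<r} \<rightarrow>\<^sub>E I) - ({..<r} \<rightarrow>\<^sub>E J)"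
    then obtain i where "i < r" "\<gamma> i \<in> I - J" by (auto simp: PiE_iff)
    hence "(\<Prod>i<r. x (\<gamma> i)) = 0" using zero by (intro prod_zero) auto
    thus "of_bool (iso_to_member (colour_graph r \<gamma>) F) * (\<Prod>i<r. x (\<gamma> i)) = 0" by simp
  qed
qed

section \<open>Sampling from a complete multipartite graphon\<close>

context
  fixes l :: nat and x :: "nat \<Rightarrow> real"
  assumes pos: "\<And>i. i < l \<Longrightarrow> x i > 0" and total: "(\<Sum>i<l. x i) = 1"
begin

lemma partial_sums_mono:
  assumes "i \<le> j" "j \<le> l" shows "(\<Sum>a<i. x a) \<le> (\<Sum>a<j. x a)"
  using assms pos by (intro sum_mono2) (auto intro: less_imp_le)

lemma part_interval_disjoint:
  assumes "i < l" "j < l" "i \<noteq> j"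
  shows "part_interval l x i \<inter> part_interval l x j = {}"
proof -
  have "part_interval l x i \<inter> part_interval l x j = {}" if "i < j" "j < l" for i j
  proof -
    have "(\<Sum>a<Suc i. x a) \<le> (\<Sum>a<j. x a)" "(\<Sum>a<j. x a) \<le> (\<Sum>a<l. x a)"
      using that by (intro partial_sums_mono; simp)+
    moreover have "(\<Sum>a<j. x a) < 1"
      using partial_sums_mono[of "Suc j" l] pos[of j] that total by simp
    ultimately show ?thesis using that by (auto simp: part_interval_def)
  qed
  from this[of i j] this[of j i] assms show ?thesis by (metis inf_commute linorder_neqE_nat)
qed

lemma prob_part_interval:
  assumes i: "i < l"
  shows "measure (uniform_measure lborel {0..1}) (part_interval l x i) = x i"
proof -
  let ?a = "\<Sum>a<i. x a"
  have bounds: "0 \<le> ?a" "?a + x i \<le> 1"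
    using partial_sums_mono[of 0 i] partial_sums_mono[of "Suc i" l] i total by auto
  have sets: "part_interval l x i \<in> sets lborel" by (simp add: part_interval_def)
  have "{0..1} \<inter> part_interval l x i = part_interval l x i"
    using bounds by (auto simp: part_interval_def)
  hence "measure (uniform_measure lborel {0..1}) (part_interval l x i)
      = measure lborel (part_interval l x i)"
    using sets by (subst measure_uniform_measure) (auto simp: measure_lborel_Icc)
  also have "\<dots> = measure lborel {?a..<?a + x i}"
  proof (cases "Suc i = l")
    case True
    have "measure lborel ({?a..<?a + x i} \<union> {1}) = measure lborel {?a..<?a + x i}"
      by (rule measure_Un_null_set) auto
    moreover have "part_interval l x i = {?a..<?a + x i} \<union> {1}"
      unfolding part_interval_def sum.lessThan_Suc using True by simp
    ultimately show ?thesis by simp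
  qed (simp add: part_interval_def)
  also have "\<dots> = x i" using pos[OF i] by simp
  finally show ?thesis .
qed

text \<open>Up to a null set the parts cover the unit interval, so the event splits into disjoint boxes,
  one for each assignment of the sample points to parts.  The complement of the parts is
  treated as one more part, of index \<open>l\<close>, in which sample points are isolated: this makes the
  decomposition of the event exact and settles its measurability.\<close>

lemma graphon_density_multipartite:
  "graphon_induced_density r F (multipartite_graphon l x) = multipartite_density r F {..<l} x"
proof -
  define M0 where "M0 = uniform_measure lborel {0..1::real}"
  define B where "B i = (if i < l then part_interval l x i else - (\<Union>j<l. part_interval l x j))" for i
  define K :: "(nat \<Rightarrow> nat) \<Rightarrow> nat graph"
    where "K \<gamma> = ({..<r}, {(i, j). i < r \<and> j < r \<and> \<gamma> i < l \<and> \<gamma> j < l \<and> \<gamma> i \<noteq> \<gamma> j})" for \<gamma>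
  let ?W = "multipartite_graphon l x"
  let ?\<Gamma> = "{..<r} \<rightarrow>\<^sub>E {..l}"
  let ?good = "{\<gamma>\<in>?\<Gamma>. iso_to_member (K \<gamma>) F}"
  let ?box = "\<lambda>\<gamma>. PiE {..<r} (\<lambda>i. B (\<gamma> i))"
  interpret M0: prob_space M0
    unfolding M0_def by (rule prob_space_uniform_measure) auto
  interpret P: finite_product_prob_space "\<lambda>_. M0" "{..<r}"
    by unfold_locales simp
  have sets_part: "part_interval l x i \<in> sets borel" for i by (simp add: part_interval_def)
  have space: "space M0 = UNIV" "sets M0 = sets borel" by (simp_all add: M0_def)
  have "(\<Union>j<l. part_interval l x j) \<in> sets borel" using sets_part by (intro sets.finite_UN) auto
  hence sets_B: "B i \<in> sets M0" for i
    unfolding B_def space by (cases "i < l") (simp_all only: if_True if_False sets_part borel_comp)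
  have disj_B: "i = j" if "i \<le> l" "j \<le> l" "s \<in> B i" "s \<in> B j" for i j s
    using that part_interval_disjoint[of i j] by (auto simp: B_def split: if_splits)
  have cover_B: "\<exists>i\<le>l. s \<in> B i" for s
  proof (cases "\<exists>j<l. s \<in> part_interval l x j")
    case True
    thus ?thesis unfolding B_def by (metis less_imp_le)
  next
    case False
    thus ?thesis by (intro exI[of _ l]) (simp add: B_def)
  qed
  have prob_B: "M0.prob (B i) = x i" if "i < l" for i
    using prob_part_interval[OF that] that by (simp add: B_def M0_def)
  \<comment> \<open>The parts already have total probability 1, which leaves nothing for the complement.\<close>
  have prob_rest: "M0.prob (B l) = 0"
  proof -
    have "M0.prob (\<Union>i\<in>{..l}. B i) = (\<Sum>i\<in>{..l}. M0.prob (B i))"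
      using sets_B disj_B
      by (intro M0.finite_measure_finite_Union) (auto simp: disjoint_family_on_def)
    also have "(\<Union>i\<in>{..l}. B i) = space M0" using cover_B by (auto simp: space)
    also have "(\<Sum>i\<in>{..l}. M0.prob (B i)) = 1 + M0.prob (B l)"
      using prob_B total by (simp add: lessThan_Suc_atMost[symmetric])
    finally show ?thesis by (simp add: M0.prob_space)
  qed
  have sampled: "sampled_graph r ?W \<omega> = K \<gamma>" if "\<gamma> \<in> ?\<Gamma>" "\<omega> \<in> ?box \<gamma>" for \<omega> \<gamma>
  proof -
    have \<gamma>: "\<gamma> i \<le> l" "\<omega> i \<in> B (\<gamma> i)" if "i < r" for i
      using \<open>\<gamma> \<in> ?\<Gamma>\<close> \<open>\<omega> \<in> ?box \<gamma>\<close> that by (auto simp: PiE_iff)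
    have part: "\<omega> i \<in> part_interval l x a \<longleftrightarrow> a = \<gamma> i" if "i < r" "a < l" for i a
      using disj_B[of a "\<gamma> i" "\<omega> i"] \<gamma>[OF that(1)] that(2) by (auto simp: B_def)
    have "?W (\<omega> i) (\<omega> j) = 1 \<longleftrightarrow> \<gamma> i < l \<and> \<gamma> j < l \<and> \<gamma> i \<noteq> \<gamma> j" if "i < r" "j < r" for i j
      using part that by (auto simp: multipartite_graphon_def)
    thus ?thesis by (auto simp: sampled_graph_def K_def)
  qed
  have event: "{\<omega> \<in> space (PiM {..<r} (\<lambda>_. M0)). iso_to_member (sampled_graph r ?W \<omega>) F}
      = (\<Union>\<gamma>\<in>?good. ?box \<gamma>)"
  proof (intro equalityI subsetI)
    fix \<omega> assume "\<omega> \<in> {\<omega> \<in> space (PiM {..<r} (\<lambda>_. M0)). iso_to_member (sampled_graph r ?W \<omega>) F}"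
    hence \<omega>: "\<omega> \<in> {..<r} \<rightarrow>\<^sub>E UNIV" "iso_to_member (sampled_graph r ?W \<omega>) F"
      by (auto simp: space_PiM space)
    obtain idx where idx: "\<And>s. idx s \<le> l" "\<And>s. s \<in> B (idx s)" using cover_B by metis
    let ?\<gamma> = "restrict (idx \<circ> \<omega>) {..<r}"
    have g: "?\<gamma> \<in> ?\<Gamma>" and b: "\<omega> \<in> ?box ?\<gamma>" using idx \<omega>(1) by (auto simp: PiE_iff)
    have "iso_to_member (K ?\<gamma>) F" using \<omega>(2) unfolding sampled[OF g b] .
    with g b show "\<omega> \<in> (\<Union>\<gamma>\<in>?good. ?box \<gamma>)" by blast
  next
    fix \<omega> assume "\<omega> \<in> (\<Union>\<gamma>\<in>?good. ?box \<gamma>)"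
    then obtain \<gamma> where \<gamma>: "\<gamma> \<in> ?\<Gamma>" "iso_to_member (K \<gamma>) F" "\<omega> \<in> ?box \<gamma>" by blast
    have "iso_to_member (sampled_graph r ?W \<omega>) F" using \<gamma>(2) unfolding sampled[OF \<gamma>(1,3)] .
    thus "\<omega> \<in> {\<omega> \<in> space (PiM {..<r} (\<lambda>_. M0)). iso_to_member (sampled_graph r ?W \<omega>) F}"
      using \<gamma>(3) by (auto simp: space_PiM space PiE_iff)
  qed
  have fin: "finite ?\<Gamma>" by (intro finite_PiE) auto
  have "graphon_induced_density r F ?W = P.prob (\<Union>\<gamma>\<in>?good. ?box \<gamma>)"
    unfolding graphon_induced_density_def M0_def[symmetric] event ..
  also have "\<dots> = (\<Sum>\<gamma>\<in>?good. P.prob (?box \<gamma>))"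
  proof (rule P.finite_measure_finite_Union)
    show "finite ?good" using fin by simp
    show "?box ` ?good \<subseteq> sets (PiM {..<r} (\<lambda>_. M0))"
      using sets_B by (auto intro!: sets_PiM_I_finite)
    show "disjoint_family_on ?box ?good"
      unfolding disjoint_family_on_def
    proof (intro ballI impI)
      fix \<gamma> \<delta> assume A: "\<gamma> \<in> ?good" "\<delta> \<in> ?good" "\<gamma> \<noteq> \<delta>"
      then obtain i where i: "i < r" "\<gamma> i \<noteq> \<delta> i"
        using PiE_ext[of \<gamma> "{..<r}" "\<lambda>_. {..l}" \<delta>] by auto
      have "\<gamma> i \<le> l" "\<delta> i \<le> l" using A i by (auto simp: PiE_iff)
      thus "?box \<gamma> \<inter> ?box \<delta> = {}" using disj_B[of "\<gamma> i" "\<delta> i"] i by (fastforce simp: PiE_iff)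
    qed
  qed
  also have "\<dots> = (\<Sum>\<gamma>\<in>?good. \<Prod>i<r. M0.prob (B (\<gamma> i)))"
    using sets_B by (intro sum.cong refl P.prob_times) auto
  also have "\<dots> = multipartite_density r F {..<l} x"
    unfolding multipartite_density_def
  proof (rule sum.mono_neutral_cong)
    show "finite ?good" "finite ({..<r} \<rightarrow>\<^sub>E {..<l})" using fin by (auto intro: finite_PiE)
    fix \<gamma> assume "\<gamma> \<in> ({..<r} \<rightarrow>\<^sub>E {..<l}) - ?good"
    hence \<gamma>: "\<gamma> \<in> {..<r} \<rightarrow>\<^sub>E {..<l}" "\<gamma> \<notin> ?good" by auto
    have "K \<gamma> = colour_graph r \<gamma>" using \<gamma>(1) by (auto simp: K_def colour_graph_def PiE_iff)
    moreover have "\<gamma> \<in> ?\<Gamma>" using \<gamma>(1) by (auto simp: PiE_iff intro: less_imp_le)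
    ultimately have "\<not> iso_to_member (colour_graph r \<gamma>) F" using \<gamma>(2) by simp
    thus "of_bool (iso_to_member (colour_graph r \<gamma>) F) * (\<Prod>i<r. x (\<gamma> i)) = 0" by simp
  next
    fix \<gamma> assume "\<gamma> \<in> ?good - ({..<r} \<rightarrow>\<^sub>E {..<l})"
    then obtain i where "i < r" "\<gamma> i = l" by (force simp: PiE_iff)
    thus "(\<Prod>i<r. M0.prob (B (\<gamma> i))) = 0" using prob_rest by (intro prod_zero) auto
  next
    fix \<gamma> assume "\<gamma> \<in> ?good \<inter> ({..<r} \<rightarrow>\<^sub>E {..<l})"
    hence \<gamma>: "\<gamma> \<in> {..<r} \<rightarrow>\<^sub>E {..<l}" "iso_to_member (K \<gamma>) F" by auto
    have "K \<gamma> = colour_graph r \<gamma>" using \<gamma>(1) by (auto simp: K_def colour_graph_def PiE_iff)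
    moreover have "(\<Prod>i<r. M0.prob (B (\<gamma> i))) = (\<Prod>i<r. x (\<gamma> i))"
      using \<gamma>(1) prob_B by (intro prod.cong) (auto simp: PiE_iff)
    ultimately show "(\<Prod>i<r. M0.prob (B (\<gamma> i)))
        = of_bool (iso_to_member (colour_graph r \<gamma>) F) * (\<Prod>i<r. x (\<gamma> i))"
      using \<gamma>(2) by simp
  qed
  finally show ?thesis .
qed

end

section \<open>The inducibility of a symmetrizable family\<close>

lemma proper_colouring_chromatic_number:
  assumes "simple_graph H"
  obtains c where "proper_colouring H (chromatic_number H) c"
proof -
  have "finite (verts H)" using assms by (simp add: simple_graph_def)
  then obtain h where h: "bij_betw h (verts H) {0..<card (verts H)}"
    using ex_bij_betw_finite_nat by blast
  have "h u \<noteq> h v" if "(u, v) \<in> edges H" for u v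
  proof -
    have "u \<in> verts H" "v \<in> verts H" "u \<noteq> v" using that assms by (auto simp: simple_graph_def irrefl_def)
    thus ?thesis using h by (auto simp: bij_betw_def inj_on_def)
  qed
  hence "proper_colouring H (card (verts H)) h"
    using bij_betwE[OF h] by (auto simp: proper_colouring_def)
  hence "\<exists>k c. proper_colouring H k c" by blast
  hence "\<exists>c. proper_colouring H (chromatic_number H) c"
    unfolding chromatic_number_def by (rule LeastI_ex)
  thus ?thesis using that by blast
qed

lemma multipartite_free:
  assumes H: "simple_graph H" and c: "partition_colouring G l c" and l: "l < chromatic_number H"
  shows "\<not> contains_subgraph G H"
proof
  assume "contains_subgraph G H"
  then obtain f where f: "f ` verts H \<subseteq> verts G"
      "\<And>u v. u \<in> verts H \<Longrightarrow> v \<in> verts H \<Longrightarrow> (u, v) \<in> edges H \<Longrightarrow> (f u, f v) \<in> edges G"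
    unfolding contains_subgraph_def by blast
  have "proper_colouring H l (c \<circ> f)"
    unfolding proper_colouring_def
  proof (intro conjI ballI, goal_cases)
    case (1 v)
    thus ?case using f c by (auto simp: partition_colouring_def)
  next
    case (2 e)
    then obtain u v where e: "e = (u, v)" "(u, v) \<in> edges H" by (cases e) auto
    hence uv: "u \<in> verts H" "v \<in> verts H" using H by (auto simp: simple_graph_def)
    hence "f u \<in> verts G" "f v \<in> verts G" "(f u, f v) \<in> edges G" using f e by auto
    hence "c (f u) \<noteq> c (f v)" using c unfolding partition_colouring_def by blast
    thus ?case using e by simp
  qed
  hence "chromatic_number H \<le> l" unfolding chromatic_number_def by (intro Least_le) blast
  with l show False by simp
qed

text \<open>The limit of the part proportions of the multipartite maximizers may contain zeros; these
  parts carry no weight in the polynomial and are removed by relabelling the positive ones.\<close>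

lemma inducibility_complete_attained:
  assumes F: "graph_family r F" "symmetrizable F" and m: "m \<ge> 1"
  shows "\<exists>l x. l \<le> m \<and> (\<forall>i<l. x i > 0) \<and> (\<Sum>i<l. x i) = 1 \<and>
    graphon_induced_density r F (multipartite_graphon l x)
      = inducibility (complete_nat_graph (Suc m)) r F"
proof -
  let ?K = "complete_nat_graph (Suc m)"
  have "\<forall>n. \<exists>(G :: nat graph) c. simple_graph G \<and> card (verts G) = n \<and> partition_colouring G m c \<and>
      max_induced_frac ?K r F n = induced_frac r F G"
    using multipartite_maximizer[OF F m] by metis
  then obtain G :: "nat \<Rightarrow> nat graph" and c where G: "\<And>n. simple_graph (G n)" "\<And>n. card (verts (G n)) = n"
      "\<And>n. partition_colouring (G n) m (c n)" "\<And>n. max_induced_frac ?K r F n = induced_frac r F (G n)"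
    by metis
  have fin: "finite (verts (G n))" for n using G(1) by (simp add: simple_graph_def)
  define y where "y n i = real (card {v \<in> verts (G n). c n v = i}) / real n" for n i
  have y01: "y n i \<in> {0..1}" for n i
  proof -
    have "card {v \<in> verts (G n). c n v = i} \<le> n"
      using card_mono[OF fin, of "{v \<in> verts (G n). c n v = i}" n] G(2)[of n] by simp
    thus ?thesis by (simp add: y_def divide_le_eq)
  qed
  obtain s :: "nat \<Rightarrow> nat" and x where s: "strict_mono s" and x: "\<And>i. i < m \<Longrightarrow> (\<lambda>n. y (s n) i) \<longlonglongrightarrow> x i"
    using convergent_subsequence_finitely_many[of y m] y01 by blast
  have nonneg: "x i \<ge> 0" if "i < m" for i
    using x[OF that] y01 by (intro LIMSEQ_le_const) auto
  have sum_y: "(\<Sum>i<m. y n i) = 1" if "n > 0" for n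
  proof -
    have "(\<Sum>i<m. card {v \<in> verts (G n). c n v = i}) = card (\<Union>i<m. {v \<in> verts (G n). c n v = i})"
      using fin by (intro card_UN_disjoint[symmetric]) auto
    also have "(\<Union>i<m. {v \<in> verts (G n). c n v = i}) = verts (G n)"
      using G(3)[of n] by (auto simp: partition_colouring_def)
    finally have "real (\<Sum>i<m. card {v \<in> verts (G n). c n v = i}) = real n" using G(2) by simp
    thus ?thesis using that by (simp add: y_def sum_divide_distrib[symmetric])
  qed
  have s_top: "filterlim s at_top sequentially" using s by (rule filterlim_subseq)
  have total: "(\<Sum>i<m. x i) = 1"
  proof (rule LIMSEQ_unique)
    show "(\<lambda>n. \<Sum>i<m. y (s n) i) \<longlonglongrightarrow> (\<Sum>i<m. x i)" using x by (intro tendsto_sum) auto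
    have "\<forall>\<^sub>F n in sequentially. (\<Sum>i<m. y (s n) i) = 1"
      using eventually_compose_filterlim[OF eventually_gt_at_top[of 0] s_top]
      by eventually_elim (rule sum_y)
    thus "(\<lambda>n. \<Sum>i<m. y (s n) i) \<longlonglongrightarrow> 1" by (rule tendsto_eventually)
  qed
  have "(\<lambda>n. induced_frac r F (G n) - multipartite_density r F {..<m} (y n)) \<longlonglongrightarrow> 0"
  proof (rule Lim_null_comparison)
    show "\<forall>\<^sub>F n in sequentially. norm (induced_frac r F (G n) - multipartite_density r F {..<m} (y n))
        \<le> 1 - injective_fraction r n"
      using eventually_gt_at_top[of r]
    proof eventually_elim
      case (elim n)
      thus ?case
        using induced_frac_multipartite_approx[OF fin[of n] _ _ G(3)[of n], of r F] G(2)[of n]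
        by (simp add: y_def[abs_def])
    qed
    show "(\<lambda>n. 1 - injective_fraction r n) \<longlonglongrightarrow> 0"
      using tendsto_diff[OF tendsto_const[of 1] tendsto_injective_fraction[of r]] by simp
  qed
  moreover have "(\<lambda>n. induced_frac r F (G n)) \<longlonglongrightarrow> inducibility ?K r F"
  proof -
    have "max_induced_frac ?K r F \<longlonglongrightarrow> inducibility ?K r F"
      using m by (intro max_induced_frac_tendsto_inducibility simple_complete_nat_graph
          edges_complete_nat_graph_nonempty) simp
    thus ?thesis unfolding G(4)[symmetric] .
  qed
  ultimately have "(\<lambda>n. multipartite_density r F {..<m} (y n)) \<longlonglongrightarrow> inducibility ?K r F"
    using tendsto_diff[of "\<lambda>n. induced_frac r F (G n)"] by fastforce
  hence "(\<lambda>n. multipartite_density r F {..<m} (y (s n))) \<longlonglongrightarrow> inducibility ?K r F"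
    using s_top by (rule filterlim_compose)
  moreover have "(\<lambda>n. multipartite_density r F {..<m} (y (s n))) \<longlonglongrightarrow> multipartite_density r F {..<m} x"
    unfolding multipartite_density_def
    using x by (intro tendsto_sum tendsto_mult tendsto_const tendsto_prod) (auto simp: PiE_iff)
  ultimately have density: "multipartite_density r F {..<m} x = inducibility ?K r F"
    by (rule LIMSEQ_unique[rotated])
  define I where "I = {i. i < m \<and> x i > 0}"
  define l where "l = card I"
  have I: "finite I" "I \<subseteq> {..<m}" "\<And>i. i \<in> {..<m} - I \<Longrightarrow> x i = 0"
    using nonneg by (auto simp: I_def less_le)
  obtain e where e: "bij_betw e {..<l} I"
    using ex_bij_betw_nat_finite[OF I(1)] by (auto simp: l_def atLeast0LessThan)
  have "l \<le> m" using card_mono[OF _ I(2)] by (simp add: l_def)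
  moreover have pos: "(x \<circ> e) i > 0" if "i < l" for i
    using bij_betwE[OF e] that by (auto simp: I_def)
  moreover have tot: "(\<Sum>i<l. (x \<circ> e) i) = 1"
  proof -
    have "(\<Sum>i<l. (x \<circ> e) i) = sum x I" using sum.reindex_bij_betw[OF e, of x] by simp
    also have "\<dots> = (\<Sum>i<m. x i)" using I by (intro sum.mono_neutral_left) auto
    finally show ?thesis using total by simp
  qed
  moreover have "graphon_induced_density r F (multipartite_graphon l (x \<circ> e)) = inducibility ?K r F"
  proof -
    have "graphon_induced_density r F (multipartite_graphon l (x \<circ> e))
        = multipartite_density r F {..<l} (x \<circ> e)"
      using graphon_density_multipartite[OF pos tot] .
    also have "\<dots> = multipartite_density r F I x"
      using multipartite_density_relabel[of e "{..<l}" r F x] e by (simp add: bij_betw_def)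
    also have "\<dots> = multipartite_density r F {..<m} x"
      using I by (intro multipartite_density_drop_empty_parts) auto
    finally show ?thesis using density by simp
  qed
  ultimately show ?thesis by blast
qed

theorem theorem1p3:
  fixes F :: "nat graph set" and r :: nat and H :: "'h graph"
  assumes "graph_family r F"
    and "symmetrizable F"
    and "simple_graph H"
    and "chromatic_number H \<ge> 3"
  shows "inducibility H r F = inducibility (complete_nat_graph (chromatic_number H)) r F \<and>
    (\<exists>l (x :: nat \<Rightarrow> real).
       l < chromatic_number H \<and> (\<forall>i<l. x i > 0) \<and> (\<Sum>i<l. x i) = 1 \<and>
       graphon_induced_density r F (multipartite_graphon l x) = inducibility H r F)"
proof -
  define m where "m = chromatic_number H - 1"
  have k: "chromatic_number H = Suc m" and m: "m \<ge> 1" using assms(4) by (simp_all add: m_def)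
  let ?K = "complete_nat_graph (Suc m)"
  have edges: "edges H \<noteq> {}" using assms(4) by (intro edges_nonempty_if_chromatic_number_ge_2) simp
  obtain c where "proper_colouring H (Suc m) c"
    using proper_colouring_chromatic_number[OF assms(3)] k by metis
  hence upper: "inducibility H r F \<le> inducibility ?K r F"
    using m by (intro inducibility_le_complete[OF assms(3) edges]) auto
  have "max_induced_frac ?K r F n \<le> max_induced_frac H r F n" for n
  proof -
    obtain G :: "nat graph" and c where G: "simple_graph G" "card (verts G) = n"
        "partition_colouring G m c" "max_induced_frac ?K r F n = induced_frac r F G"
      by (rule multipartite_maximizer[OF assms(1,2) m])
    have "\<not> contains_subgraph G H" using multipartite_free[OF assms(3) G(3)] k by simp
    from max_induced_frac_upper[OF G(1) this, of r F] show ?thesis using G by simp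
  qed
  hence "inducibility ?K r F \<le> inducibility H r F"
    using m by (intro LIMSEQ_le[OF max_induced_frac_tendsto_inducibility[OF simple_complete_nat_graph
            edges_complete_nat_graph_nonempty] max_induced_frac_tendsto_inducibility[OF assms(3) edges]]) auto
  with upper have eq: "inducibility H r F = inducibility ?K r F" by simp
  show ?thesis
    using inducibility_complete_attained[OF assms(1,2) m] unfolding eq k less_Suc_eq_le by simp
qed

end
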